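(* Let $X,Y$ be Banach spaces and $T\in\mathcal L(X,Y)$ a bounded linear operator. The following are equivalent: (i) $T$ is not Tauberian; (ii) there exists a wide-$(s)$ sequence $(x_j)$ in $X$ with $(Tx_j)$ norm-convergent; (iii) there exists a wide-$(c)$ sequence $(e_j)$ in $X$ with $\sum_j\|Te_j\|<\infty$.
   Context: $X$ is regarded as a subspace of $X^{**}$ canonically. $T\in\mathcal L(X,Y)$ is Tauberian if $T^{**}(X^{**}\setminus X)\subset Y^{**}\setminus Y$. A sequence is semi-normalized if $0<\inf_j\|b_j\|\le\sup_j\|b_j\|<\infty$. A semi-normalized sequence $(b_j)$ is wide-$(s)$ if it is a basic sequence such that $\sum_j c_j$ converges whenever $\sum_j c_jb_j$ converges. A semi-normalized sequence $(e_j)$ is wide-$(c)$ if it is a basic sequence with $\sup_n\|\sum_{j=1}^n e_j\|<\infty$. *)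

theory Defs
  imports "HOL-Analysis.Analysis"
begin

definition canon :: "'a::real_normed_vector \<Rightarrow> (('a \<Rightarrow>\<^sub>L real) \<Rightarrow>\<^sub>L real)" where
  "canon x = Blinfun (\<lambda>f. blinfun_apply f x)"

definition bidual_op :: "('a::real_normed_vector \<Rightarrow>\<^sub>L 'b::real_normed_vector)
    \<Rightarrow> (('a \<Rightarrow>\<^sub>L real) \<Rightarrow>\<^sub>L real) \<Rightarrow> (('b \<Rightarrow>\<^sub>L real) \<Rightarrow>\<^sub>L real)" where
  "bidual_op T \<phi> = Blinfun (\<lambda>g. blinfun_apply \<phi> (g o\<^sub>L T))"

definition tauberian :: "('a::real_normed_vector \<Rightarrow>\<^sub>L 'b::real_normed_vector) \<Rightarrow> bool" where
  "tauberian T \<longleftrightarrow> bidual_op T ` (UNIV - range canon) \<subseteq> UNIV - range canon"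

definition semi_normalized :: "(nat \<Rightarrow> 'a::real_normed_vector) \<Rightarrow> bool" where
  "semi_normalized b \<longleftrightarrow> (\<exists>a>0. \<forall>j. a \<le> norm (b j)) \<and> (\<exists>M. \<forall>j. norm (b j) \<le> M)"

definition basic_seq :: "(nat \<Rightarrow> 'a::real_normed_vector) \<Rightarrow> bool" where
  "basic_seq b \<longleftrightarrow> (\<forall>x \<in> closure (span (range b)).
      \<exists>!c::nat \<Rightarrow> real. (\<lambda>j. c j *\<^sub>R b j) sums x)"

definition wide_s :: "(nat \<Rightarrow> 'a::real_normed_vector) \<Rightarrow> bool" where
  "wide_s b \<longleftrightarrow> semi_normalized b \<and> basic_seq b \<and>
     (\<forall>c::nat \<Rightarrow> real. summable (\<lambda>j. c j *\<^sub>R b j) \<longrightarrow> summable c)"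

definition wide_c :: "(nat \<Rightarrow> 'a::real_normed_vector) \<Rightarrow> bool" where
  "wide_c e \<longleftrightarrow> semi_normalized e \<and> basic_seq e \<and>
     (\<exists>M. \<forall>n. norm (\<Sum>j<n. e j) \<le> M)"

end

theory Submission
  imports Defs
begin

text \<open>
  If \<open>T\<close> is not Tauberian, some \<open>\<phi>\<close> in the bidual, at positive distance from \<open>X\<close>, is mapped
  by \<open>T\<^sup>*\<^sup>*\<close> to some \<open>y\<close> in \<open>Y\<close>.  A strengthened form of Goldstine's theorem yields successively
  \<open>x\<^sub>n\<close> in \<open>X\<close> with \<open>\<parallel>T x\<^sub>n - y\<parallel> \<le> 2\<^sup>-\<^sup>n\<close> such that \<open>x\<^sub>n - \<phi>\<close> is almost orthogonal to the span
  of \<open>\<phi>, x\<^sub>0, \<dots>, x\<^sub>n\<^sub>-\<^sub>1\<close>.  Then \<open>\<phi>, x\<^sub>0 - \<phi>, x\<^sub>1 - \<phi>, \<dots>\<close> is basic.  As \<open>\<phi>\<close> has positive distance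
  from \<open>X\<close>, it follows that \<open>x\<close> is basic and that some functional is \<open>1\<close> on all \<open>x\<^sub>n\<close>; hence \<open>x\<close>
  is wide-(s) and its difference sequence is wide-(c).

  Conversely, let \<open>T\<close> be Tauberian and \<open>(x\<^sub>n)\<close> bounded with \<open>T x\<^sub>n\<close> convergent.  The limit
  functional extends to a \<open>\<phi>\<close> in the bidual with \<open>T\<^sup>*\<^sup>* \<phi>\<close> in \<open>Y\<close>, so \<open>\<phi>\<close> is some \<open>u\<close> in \<open>X\<close>, and
  \<open>f u = lim f x\<^sub>n\<close> whenever the limit exists.  If \<open>x\<close> is wide-(s), then all coordinates of \<open>u\<close>
  vanish, so \<open>u = 0\<close>, whereas the functional that is \<open>1\<close> on all \<open>x\<^sub>n\<close> gives \<open>1\<close>.  If \<open>x\<^sub>n\<close> are the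
  partial sums of a wide-(c) sequence \<open>e\<close>, then all coordinates of \<open>u\<close> are \<open>1\<close>, so \<open>\<Sum>e\<^sub>j\<close>
  converges, contradicting \<open>inf \<parallel>e\<^sub>j\<parallel> > 0\<close>.
\<close>

subsection \<open>The Mazur-Orlicz theorem\<close>

definition sublinear :: "('v::real_vector \<Rightarrow> real) \<Rightarrow> bool" where
  "sublinear p \<longleftrightarrow> (\<forall>x y. p (x + y) \<le> p x + p y) \<and> (\<forall>t>0. \<forall>x. p (t *\<^sub>R x) = t * p x)"

lemma sublinear_add: "sublinear p \<Longrightarrow> p (x + y) \<le> p x + p y"
  and sublinear_scaleR: "sublinear p \<Longrightarrow> 0 < t \<Longrightarrow> p (t *\<^sub>R x) = t * p x"
  by (auto simp: sublinear_def)

lemma sublinear_zero: "sublinear p \<Longrightarrow> p 0 = 0"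
  using sublinear_scaleR[of p 2 0] by simp

lemma sublinear_minus_le: "sublinear p \<Longrightarrow> - p (- x) \<le> p x"
  using sublinear_add[of p x "- x"] sublinear_zero[of p] by simp

lemma sublinearI:
  assumes add: "\<And>x y. p (x + y) \<le> p x + p y"
    and scale_le: "\<And>t x. 0 < t \<Longrightarrow> p (t *\<^sub>R x) \<le> t * p x"
  shows "sublinear p"
proof -
  have "t * p x \<le> p (t *\<^sub>R x)" if "0 < t" for t x
    using scale_le[of "1 / t" "t *\<^sub>R x"] that by (simp add: field_simps)
  with assms show ?thesis by (auto simp: sublinear_def intro: antisym)
qed

lemma sublinear_norm: "0 \<le> C \<Longrightarrow> sublinear (\<lambda>x::'v::real_normed_vector. C * norm x)"
  by (rule sublinearI) (simp_all add: mult_left_mono norm_triangle_ineq flip: distrib_left)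

lemma sublinear_INF:
  fixes q :: "'i \<Rightarrow> 'v::real_vector \<Rightarrow> real"
  assumes "I \<noteq> {}" and bdd: "\<And>x. bdd_below ((\<lambda>i. q i x) ` I)"
    and add: "\<And>i j x y. i \<in> I \<Longrightarrow> j \<in> I \<Longrightarrow> \<exists>k\<in>I. q k (x + y) \<le> q i x + q j y"
    and scale: "\<And>i t x. i \<in> I \<Longrightarrow> 0 < t \<Longrightarrow> \<exists>k\<in>I. q k (t *\<^sub>R x) \<le> t * q i x"
  shows "sublinear (\<lambda>x. INF i\<in>I. q i x)"
proof (rule sublinearI)
  let ?p = "\<lambda>x. INF i\<in>I. q i x"
  have greatest: "m \<le> ?p x" if "\<And>i. i \<in> I \<Longrightarrow> m \<le> q i x" for m x
    using \<open>I \<noteq> {}\<close> that by (rule cINF_greatest)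
  show "?p (x + y) \<le> ?p x + ?p y" for x y
  proof -
    have "?p (x + y) - q i x \<le> ?p y" if "i \<in> I" for i
    proof (rule greatest)
      fix j assume "j \<in> I"
      then obtain k where "k \<in> I" "q k (x + y) \<le> q i x + q j y"
        using add[OF \<open>i \<in> I\<close>] by blast
      then show "?p (x + y) - q i x \<le> q j y"
        using cINF_lower[OF bdd, of k "x + y"] by linarith
    qed
    then have "?p (x + y) - ?p y \<le> ?p x"
      by (intro greatest) (simp add: diff_le_eq add.commute)
    then show ?thesis by simp
  qed
  show "?p (t *\<^sub>R x) \<le> t * ?p x" if t: "0 < t" for t x
  proof -
    have "?p (t *\<^sub>R x) / t \<le> ?p x"
    proof (rule greatest)
      fix i assume "i \<in> I"
      then obtain k where "k \<in> I" "q k (t *\<^sub>R x) \<le> t * q i x"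
        using scale[OF _ t] by blast
      then show "?p (t *\<^sub>R x) / t \<le> q i x"
        using t cINF_lower[OF bdd, of k "t *\<^sub>R x"] by (simp add: field_simps)
    qed
    with t show ?thesis by (simp add: field_simps)
  qed
qed

text \<open>The linear functions below \<open>cone_relaxation K p\<close> are the linear functions \<open>l \<le> p\<close> with
  \<open>a \<le> l z\<close> for all \<open>(z, a) \<in> K\<close>.\<close>

definition cone_relaxation :: "('v \<times> real) set \<Rightarrow> ('v::real_vector \<Rightarrow> real) \<Rightarrow> 'v \<Rightarrow> real" where
  "cone_relaxation K p x = (INF k\<in>convex_cone hull K. p (x + fst k) - snd k)"

lemma le_sublinear_on_convex_cone_hull:
  assumes p: "sublinear p" and K: "convex K" "\<And>z a. (z, a) \<in> K \<Longrightarrow> a \<le> p z"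
    and k: "k \<in> convex_cone hull K"
  shows "snd k \<le> p (fst k)"
proof (cases "k = 0")
  case True
  then show ?thesis by (simp add: sublinear_zero[OF p])
next
  case False
  with k K(1) obtain t z a where "k = t *\<^sub>R (z, a)" "0 < t" "(z, a) \<in> K"
    by (auto simp: convex_cone_hull_convex_hull hull_same order.order_iff_strict zero_prod_def)
  with K(2) show ?thesis by (simp add: sublinear_scaleR[OF p])
qed

context
  fixes p :: "'v::real_vector \<Rightarrow> real" and K :: "('v \<times> real) set"
  assumes p: "sublinear p" and K: "convex K" "\<And>z a. (z, a) \<in> K \<Longrightarrow> a \<le> p z"
begin

lemma bdd_below_cone_relaxation: "bdd_below ((\<lambda>k. p (x + fst k) - snd k) ` (convex_cone hull K))"
proof (rule bdd_belowI2)
  fix k assume "k \<in> convex_cone hull K"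
  then have "snd k \<le> p (fst k)" using le_sublinear_on_convex_cone_hull[OF p K] by blast
  then show "- p (- x) \<le> p (x + fst k) - snd k"
    using sublinear_add[OF p, of "x + fst k" "- x"] by simp
qed

lemma cone_relaxation_le: "k \<in> convex_cone hull K \<Longrightarrow> cone_relaxation K p x \<le> p (x + fst k) - snd k"
  unfolding cone_relaxation_def by (rule cINF_lower[OF bdd_below_cone_relaxation])

lemma cone_relaxation_le_self: "cone_relaxation K p x \<le> p x"
  using cone_relaxation_le[OF convex_cone_hull_contains_0] by simp

lemma cone_relaxation_minus_le: "(z, a) \<in> K \<Longrightarrow> cone_relaxation K p (- z) \<le> - a"
  using cone_relaxation_le[OF hull_inc, of "(z, a)" "- z"] by (simp add: sublinear_zero[OF p])

lemma sublinear_cone_relaxation: "sublinear (cone_relaxation K p)"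
  unfolding cone_relaxation_def
proof (rule sublinear_INF[OF convex_cone_hull_nonempty bdd_below_cone_relaxation])
  let ?C = "convex_cone hull K"
  show "\<exists>k\<in>?C. p (x + y + fst k) - snd k \<le> p (x + fst i) - snd i + (p (y + fst j) - snd j)"
    if "i \<in> ?C" "j \<in> ?C" for i j x y
  proof (rule bexI)
    show "p (x + y + fst (i + j)) - snd (i + j) \<le> p (x + fst i) - snd i + (p (y + fst j) - snd j)"
      using sublinear_add[OF p, of "x + fst i" "y + fst j"] by (simp add: algebra_simps)
    show "i + j \<in> ?C" by (rule convex_cone_hull_add[OF that])
  qed
  show "\<exists>k\<in>?C. p (t *\<^sub>R x + fst k) - snd k \<le> t * (p (x + fst i) - snd i)"
    if "i \<in> ?C" "0 < t" for i t x
  proof (rule bexI)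
    show "p (t *\<^sub>R x + fst (t *\<^sub>R i)) - snd (t *\<^sub>R i) \<le> t * (p (x + fst i) - snd i)"
      using sublinear_scaleR[OF p \<open>0 < t\<close>, of "x + fst i"] by (simp add: algebra_simps)
    show "t *\<^sub>R i \<in> ?C" using that by (simp add: convex_cone_hull_mul)
  qed
qed

end

lemma minimal_sublinear_imp_linear:
  assumes q: "sublinear q"
    and minimal: "\<And>r. sublinear r \<Longrightarrow> r \<le> q \<Longrightarrow> r = q"
  shows "linear q"
proof -
  have odd: "q (- x) = - q x" for x
  proof (rule antisym)
    let ?r = "cone_relaxation {(x, q x)} q"
    have "?r = q"
      by (intro minimal sublinear_cone_relaxation le_funI cone_relaxation_le_self) (auto simp: q)
    moreover have "?r (- x) \<le> - q x"
      by (rule cone_relaxation_minus_le) (auto simp: q)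
    ultimately show "q (- x) \<le> - q x" by simp
    show "- q x \<le> q (- x)" using sublinear_minus_le[OF q, of "- x"] by simp
  qed
  show ?thesis
  proof (rule linearI)
    fix x y
    have "q x \<le> q (x + y) + q (- y)" using sublinear_add[OF q, of "x + y" "- y"] by simp
    then show "q (x + y) = q x + q y" using odd[of y] sublinear_add[OF q, of x y] by linarith
  next
    fix t :: real and x
    consider (pos) "0 < t" | (zero) "t = 0" | (neg) "0 < - t" by linarith
    then show "q (t *\<^sub>R x) = t *\<^sub>R q x"
    proof cases
      case neg
      then show ?thesis using sublinear_scaleR[OF q neg, of x] odd[of "t *\<^sub>R x"] by simp
    qed (auto simp: sublinear_scaleR[OF q] sublinear_zero[OF q])
  qed
qed

lemma sublinear_INF_chain:
  assumes "C \<noteq> {}" and C: "\<And>q. q \<in> C \<Longrightarrow> sublinear q" "\<And>q. q \<in> C \<Longrightarrow> q \<le> p"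
    and chain: "\<And>q r. q \<in> C \<Longrightarrow> r \<in> C \<Longrightarrow> q \<le> r \<or> r \<le> q"
  shows "sublinear (\<lambda>x. INF q\<in>C. q x)" and "q \<in> C \<Longrightarrow> (INF q\<in>C. q x) \<le> q x"
proof -
  have bdd: "bdd_below ((\<lambda>q. q x) ` C)" for x
  proof (rule bdd_belowI2)
    fix q assume q: "q \<in> C"
    show "- p (- x) \<le> q x"
      using sublinear_minus_le[OF C(1)[OF q], of x] le_funD[OF C(2)[OF q], of "- x"] by linarith
  qed
  then show "(INF q\<in>C. q x) \<le> q x" if "q \<in> C"
    using that by (rule cINF_lower)
  show "sublinear (\<lambda>x. INF q\<in>C. q x)"
  proof (rule sublinear_INF[OF \<open>C \<noteq> {}\<close> bdd])
    fix q r x y assume "q \<in> C" "r \<in> C"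
    then obtain s where s: "s \<in> C" "s \<le> q" "s \<le> r" using chain by blast
    have "s (x + y) \<le> q x + r y"
      using sublinear_add[OF C(1)[OF s(1)], of x y] le_funD[OF s(2), of x] le_funD[OF s(3), of y]
      by linarith
    with s(1) show "\<exists>s\<in>C. s (x + y) \<le> q x + r y" by blast
  next
    fix q x and t :: real assume "q \<in> C" "0 < t"
    then show "\<exists>r\<in>C. r (t *\<^sub>R x) \<le> t * q x"
      using sublinear_scaleR[OF C(1)] by (intro bexI[of _ q]) simp_all
  qed
qed

theorem ex_linear_le_sublinear:
  assumes p: "sublinear p"
  shows "\<exists>l. linear l \<and> l \<le> p"
proof -
  let ?A = "{q. sublinear q \<and> q \<le> p}"
  let ?P = "\<lambda>q r :: 'a \<Rightarrow> real. r \<le> q"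
  have "\<exists>m\<in>?A. \<forall>q\<in>?A. ?P m q \<longrightarrow> q = m"
  proof (rule predicate_Zorn)
    show "partial_order_on ?A (relation_of ?P ?A)"
      by (rule partial_order_on_relation_ofI) auto
  next
    fix C assume "C \<in> Chains (relation_of ?P ?A)"
    then have C: "\<And>q. q \<in> C \<Longrightarrow> sublinear q" "\<And>q. q \<in> C \<Longrightarrow> q \<le> p"
      and chain: "\<And>q r. q \<in> C \<Longrightarrow> r \<in> C \<Longrightarrow> q \<le> r \<or> r \<le> q"
      unfolding Chains_def relation_of_def by auto
    show "\<exists>u\<in>?A. \<forall>q\<in>C. ?P q u"
    proof (cases "C = {}")
      case True
      then show ?thesis using p by auto
    next
      case False
      let ?u = "\<lambda>x. INF q\<in>C. q x"
      have u: "sublinear ?u" "\<And>q. q \<in> C \<Longrightarrow> ?u \<le> q"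
        using sublinear_INF_chain[OF False C chain] by (auto simp: le_fun_def)
      with False C(2) show ?thesis by (blast intro: order_trans)
    qed
  qed
  then obtain m where m: "sublinear m" "m \<le> p"
    "\<And>q. sublinear q \<Longrightarrow> q \<le> p \<Longrightarrow> q \<le> m \<Longrightarrow> q = m"
    by auto
  have "linear m"
    by (rule minimal_sublinear_imp_linear[OF m(1)]) (blast intro: m order_trans[OF _ m(2)])
  with m(2) show ?thesis by blast
qed

theorem mazur_orlicz:
  assumes p: "sublinear p" and K: "convex K" "\<And>z a. (z, a) \<in> K \<Longrightarrow> a \<le> p z"
  shows "\<exists>l. linear l \<and> (\<forall>x. l x \<le> p x) \<and> (\<forall>(z, a)\<in>K. a \<le> l z)"
proof -
  obtain l where l: "linear l" "\<And>x. l x \<le> cone_relaxation K p x"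
    using ex_linear_le_sublinear[OF sublinear_cone_relaxation[OF p K]] by (auto simp: le_fun_def)
  have "l x \<le> p x" for x
    using l(2)[of x] cone_relaxation_le_self[OF p K, of x] by linarith
  moreover have "a \<le> l z" if "(z, a) \<in> K" for z a
    using l(2)[of "- z"] cone_relaxation_minus_le[OF p K that] linear_neg[OF l(1), of z] by linarith
  ultimately show ?thesis using l(1) by blast
qed

subsection \<open>Bounded functionals with prescribed lower bounds\<close>

lemma linear_le_norm_imp_blinfun:
  fixes l :: "'a::real_normed_vector \<Rightarrow> real"
  assumes l: "linear l" and le_norm: "\<And>x. l x \<le> C * norm x" and C: "0 \<le> C"
  obtains f :: "'a \<Rightarrow>\<^sub>L real" where "\<And>x. f x = l x" "norm f \<le> C"
proof -
  have abs_le_norm: "norm (l x) \<le> C * norm x" for x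
    using le_norm[of x] le_norm[of "- x"] linear_neg[OF l, of x] by simp
  then have "bounded_linear l"
    by (intro bounded_linear_intro[where K = C])
       (simp_all add: linear_add[OF l] linear_scale[OF l] mult.commute)
  then have apply_eq: "blinfun_apply (Blinfun l) x = l x" for x
    by (simp add: bounded_linear_Blinfun_apply)
  moreover have "norm (Blinfun l) \<le> C"
    using abs_le_norm C by (intro norm_blinfun_bound) (simp_all add: apply_eq)
  ultimately show thesis by (rule that)
qed

theorem mazur_orlicz_blinfun:
  fixes K :: "('a::real_normed_vector \<times> real) set"
  assumes K: "convex K" "\<And>z a. (z, a) \<in> K \<Longrightarrow> a \<le> C * norm z" and C: "0 \<le> C"
  shows "\<exists>f :: 'a \<Rightarrow>\<^sub>L real. norm f \<le> C \<and> (\<forall>(z, a)\<in>K. a \<le> blinfun_apply f z)"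
proof -
  obtain l where l: "linear l" "\<And>x. l x \<le> C * norm x" "\<forall>(z, a)\<in>K. a \<le> l z"
    using mazur_orlicz[OF sublinear_norm[OF C] K] by blast
  obtain f :: "'a \<Rightarrow>\<^sub>L real" where "\<And>x. f x = l x" "norm f \<le> C"
    using linear_le_norm_imp_blinfun[OF l(1,2) C] by blast
  with l(3) show ?thesis by (intro exI[of _ f]) simp
qed

lemma mult_norm_blinfun_le_if_le_on_cball:
  fixes f :: "'a::real_normed_vector \<Rightarrow>\<^sub>L real"
  assumes R: "0 \<le> R" and le_on_cball: "\<And>x. norm x \<le> R \<Longrightarrow> f x \<le> c"
  shows "R * norm f \<le> c"
proof (cases "R = 0")
  case True
  then show ?thesis using le_on_cball[of 0] by simp
next
  case False
  with R have R: "0 < R" by simp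
  have le_norm: "f x \<le> c / R * norm x" for x
  proof (cases "x = 0")
    case False
    then have "f ((R / norm x) *\<^sub>R x) \<le> c" using R by (intro le_on_cball) simp
    then show ?thesis using R False by (simp add: blinfun.scaleR_right field_simps)
  qed simp
  have "norm f \<le> c / R"
  proof (rule norm_blinfun_bound)
    show "0 \<le> c / R" using R le_on_cball[of 0] by simp
    show "norm (f x) \<le> c / R * norm x" for x
      using le_norm[of x] le_norm[of "- x"] by (simp add: blinfun.minus_right abs_le_iff)
  qed
  with R show ?thesis by (simp add: field_simps)
qed

lemma ex_norming_blinfun:
  fixes x :: "'a::real_normed_vector"
  obtains f :: "'a \<Rightarrow>\<^sub>L real" where "norm f \<le> 1" "norm x \<le> f x"
  using mazur_orlicz_blinfun[of "{(x, norm x)}" 1] by auto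

lemma convex_image_diff_linear:
  assumes "convex S" "linear h"
  shows "convex ((\<lambda>x. (z - h x, a::real)) ` S)"
proof -
  have "linear (\<lambda>x. (- h x, 0::real))"
    using assms(2) by (intro linearI) (simp_all add: linear_add linear_scale)
  then have "convex ((+) (z, a) ` (\<lambda>x. (- h x, 0)) ` S)"
    using assms(1) by (intro convex_translation convex_linear_image)
  then show ?thesis by (simp add: image_image)
qed

lemma ex_blinfun_separating_subspace:
  fixes x :: "'a::real_normed_vector"
  assumes M: "subspace M" and d: "\<And>u. u \<in> M \<Longrightarrow> d \<le> norm (x - u)"
  obtains f :: "'a \<Rightarrow>\<^sub>L real" where "norm f \<le> 1" "\<And>u. u \<in> M \<Longrightarrow> f u = 0" "d \<le> f x"
proof -
  let ?K = "(\<lambda>u. (x - u, d)) ` M"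
  have "convex ?K"
    using convex_image_diff_linear[OF subspace_imp_convex[OF M] linear_ident] .
  moreover have "a \<le> 1 * norm z" if "(z, a) \<in> ?K" for z a
    using that d by auto
  ultimately obtain f :: "'a \<Rightarrow>\<^sub>L real" where f: "norm f \<le> 1" "\<And>z a. (z, a) \<in> ?K \<Longrightarrow> a \<le> f z"
    using mazur_orlicz_blinfun[of ?K 1] zero_le_one by blast
  have d_le: "d \<le> f x - f u" if "u \<in> M" for u
    using f(2)[of "x - u" d] that by (simp add: blinfun.diff_right)
  have "f u = 0" if u: "u \<in> M" for u
  proof (rule ccontr)
    assume "f u \<noteq> 0"
    then have "f (((f x - d + 1) / f u) *\<^sub>R u) = f x - d + 1"
      by (simp add: blinfun.scaleR_right)
    with d_le[OF subspace_scale[OF M u], of "(f x - d + 1) / f u"] show False by simp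
  qed
  with d_le[OF subspace_0[OF M]] f(1) that show thesis by simp
qed

lemma in_closure_subspaceI:
  fixes x :: "'a::real_normed_vector"
  assumes M: "subspace M"
    and annihilated: "\<And>f :: 'a \<Rightarrow>\<^sub>L real. (\<And>u. u \<in> M \<Longrightarrow> f u = 0) \<Longrightarrow> f x = 0"
  shows "x \<in> closure M"
proof (rule ccontr)
  assume "x \<notin> closure M"
  moreover have "M \<noteq> {}" using subspace_0[OF M] by auto
  ultimately have pos: "0 < infdist x M"
    using in_closure_iff_infdist_zero[of M x] infdist_nonneg[of x M] by force
  have "infdist x M \<le> norm (x - u)" if "u \<in> M" for u
    using infdist_le[OF that, of x] by (simp add: dist_norm)
  then obtain f :: "'a \<Rightarrow>\<^sub>L real" where "\<And>u. u \<in> M \<Longrightarrow> f u = 0" "infdist x M \<le> f x"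
    using ex_blinfun_separating_subspace[OF M] by blast
  with annihilated[of f] pos show False by simp
qed

subsection \<open>The canonical embedding and Goldstine's theorem\<close>

lemma canon_apply [simp]: "blinfun_apply (canon x) f = blinfun_apply f x"
  unfolding canon_def by (subst bounded_linear_Blinfun_apply) (auto intro: bounded_linear_intros)

lemma bidual_op_apply [simp]: "blinfun_apply (bidual_op T \<phi>) g = \<phi> (g o\<^sub>L T)"
proof -
  have "bounded_linear (\<lambda>g. \<phi> (g o\<^sub>L T))"
    by (intro bounded_linear_intros)
  then show ?thesis by (simp add: bidual_op_def bounded_linear_Blinfun_apply)
qed

lemma linear_canon: "linear canon"
  by (rule linearI) (auto intro!: blinfun_eqI simp: blinfun.bilinear_simps)

lemma norm_canon [simp]: "norm (canon x) = norm x"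
proof (rule antisym)
  show "norm (canon x) \<le> norm x"
    by (rule norm_blinfun_bound)
       (auto simp: mult.commute[of "norm x"] norm_blinfun simp del: real_norm_def)
  obtain f where f: "norm f \<le> 1" "norm x \<le> blinfun_apply f x"
    by (rule ex_norming_blinfun)
  have "norm x \<le> norm (canon x) * norm f"
    using norm_blinfun[of "canon x" f] f by simp
  also have "\<dots> \<le> norm (canon x)" using f(1) by (simp add: mult_right_le_one_le)
  finally show "norm x \<le> norm (canon x)" .
qed

lemma canon_sum_scaleR: "canon (\<Sum>j\<in>J. c j *\<^sub>R x j) = (\<Sum>j\<in>J. c j *\<^sub>R canon (x j))"
  by (simp add: linear_sum[OF linear_canon] linear_scale[OF linear_canon])

lemma closed_range_canon: "closed (range (canon :: 'a::banach \<Rightarrow> _))"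
proof -
  have "bounded_linear (canon :: 'a \<Rightarrow> _)"
    by (rule bounded_linear_intro[where K = 1])
       (auto simp: linear_add[OF linear_canon] linear_scale[OF linear_canon])
  then have "complete (canon ` (UNIV :: 'a set))"
    by (intro complete_isometric_image[of 1]) (auto simp: complete_UNIV)
  then show ?thesis by (simp add: complete_eq_closed)
qed

lemma convex_Collect_eventually:
  assumes "\<And>i. convex {z. P i z}"
  shows "convex {z. \<forall>\<^sub>F i in F. P i z}"
proof (rule convexI)
  fix z w and s t :: real
  assume zw: "z \<in> {z. \<forall>\<^sub>F i in F. P i z}" "w \<in> {z. \<forall>\<^sub>F i in F. P i z}"
    and st: "0 \<le> s" "0 \<le> t" "s + t = 1"
  from zw have "\<forall>\<^sub>F i in F. P i z" "\<forall>\<^sub>F i in F. P i w" by auto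
  then have "\<forall>\<^sub>F i in F. P i (s *\<^sub>R z + t *\<^sub>R w)"
    by eventually_elim (use convexD[OF assms _ _ st] in blast)
  then show "s *\<^sub>R z + t *\<^sub>R w \<in> {z. \<forall>\<^sub>F i in F. P i z}" by simp
qed

lemma ex_bidual_extending_limits:
  fixes x :: "'i \<Rightarrow> 'a::real_normed_vector"
  assumes "F \<noteq> bot" and bound: "\<And>i. norm (x i) \<le> M"
  shows "\<exists>\<phi> :: ('a \<Rightarrow>\<^sub>L real) \<Rightarrow>\<^sub>L real.
    \<forall>f r. ((\<lambda>i. blinfun_apply f (x i)) \<longlongrightarrow> r) F \<longrightarrow> \<phi> f = r"
proof -
  define K where "K = {p :: ('a \<Rightarrow>\<^sub>L real) \<times> real. \<forall>\<^sub>F i in F. snd p \<le> blinfun_apply (fst p) (x i)}"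
  have "convex {p :: ('a \<Rightarrow>\<^sub>L real) \<times> real. snd p \<le> blinfun_apply (fst p) v}" for v
    by (rule convexI) (simp add: blinfun.bilinear_simps add_mono mult_left_mono)
  then have "convex K"
    unfolding K_def by (rule convex_Collect_eventually)
  moreover have "a \<le> M * norm f" if "(f, a) \<in> K" for f a
  proof -
    have "\<forall>\<^sub>F i in F. a \<le> blinfun_apply f (x i)" using that by (simp add: K_def)
    then obtain i where "a \<le> blinfun_apply f (x i)"
      using eventually_happens'[OF \<open>F \<noteq> bot\<close>] by blast
    also have "\<dots> \<le> norm f * norm (x i)" using norm_blinfun[of f "x i"] by simp
    also have "\<dots> \<le> M * norm f" 
      using mult_left_mono[OF bound, of "norm f" i] by (simp add: mult.commute)
    finally show ?thesis .
  qed
  moreover have "0 \<le> M" using bound norm_ge_zero order_trans by blast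
  ultimately obtain \<phi> :: "('a \<Rightarrow>\<^sub>L real) \<Rightarrow>\<^sub>L real"
    where \<phi>: "\<And>f a. (f, a) \<in> K \<Longrightarrow> a \<le> \<phi> f"
    using mazur_orlicz_blinfun[of K M] by blast
  have limit_le: "r \<le> \<phi> f" if "((\<lambda>i. blinfun_apply f (x i)) \<longlongrightarrow> r) F" for f r
  proof (rule dense_le)
    fix a assume "a < r"
    then have "\<forall>\<^sub>F i in F. a < blinfun_apply f (x i)" by (rule order_tendstoD(1)[OF that])
    then show "a \<le> \<phi> f" by (intro \<phi>) (auto simp: K_def elim: eventually_mono)
  qed
  have "\<phi> f = r" if "((\<lambda>i. blinfun_apply f (x i)) \<longlongrightarrow> r) F" for f r
    using limit_le[OF that] limit_le[of "- f" "- r"] tendsto_minus[OF that]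
    by (simp add: blinfun.minus_left blinfun.minus_right)
  then show ?thesis by blast
qed

lemma linear_functional_eq_mult_on_subspace:
  fixes m k :: "'v::real_vector \<Rightarrow> real"
  assumes "linear m" "linear k" "subspace N" and kernel: "\<And>v. v \<in> N \<Longrightarrow> k v = 0 \<Longrightarrow> m v = 0"
  shows "\<exists>a. \<forall>v\<in>N. m v = a * k v"
proof (cases "\<exists>w\<in>N. k w \<noteq> 0")
  case True
  then obtain w where w: "w \<in> N" "k w \<noteq> 0" by blast
  have "m v = m w / k w * k v" if "v \<in> N" for v
  proof -
    have "m (v - (k v / k w) *\<^sub>R w) = 0"
      using w that assms(2,3)
      by (intro kernel) (auto simp: subspace_diff subspace_scale linear_diff linear_scale)
    then show ?thesis using assms(1) by (simp add: linear_diff linear_scale)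
  qed
  then show ?thesis by blast
next
  case False
  then show ?thesis using kernel by (intro exI[of _ 0]) auto
qed

lemma linear_functional_eq_sum:
  fixes m :: "'v::real_vector \<Rightarrow> real"
  assumes "finite I" "linear m" "\<And>i. i \<in> I \<Longrightarrow> linear (l i)"
    and "\<And>v. (\<And>i. i \<in> I \<Longrightarrow> l i v = 0) \<Longrightarrow> m v = 0"
  shows "\<exists>c. \<forall>v. m v = (\<Sum>i\<in>I. c i * l i v)"
  using assms
proof (induction I arbitrary: m rule: finite_induct)
  case empty
  then show ?case by simp
next
  case (insert k I)
  let ?N = "{v. \<forall>i\<in>I. l i v = 0}"
  have "subspace ?N"
    using insert.prems(2) by (intro subspaceI) (auto simp: linear_0 linear_add linear_scale)
  then have "\<exists>a. \<forall>v\<in>?N. m v = a * l k v"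
    using insert.prems by (intro linear_functional_eq_mult_on_subspace) auto
  then obtain a where m_eq: "\<And>v. (\<And>i. i \<in> I \<Longrightarrow> l i v = 0) \<Longrightarrow> m v = a * l k v" by blast
  have "\<exists>c. \<forall>v. m v - a * l k v = (\<Sum>i\<in>I. c i * l i v)"
  proof (rule insert.IH)
    show "linear (\<lambda>v. m v - a * l k v)"
      using insert.prems(1,2) by (intro linearI) (auto simp: linear_add linear_scale algebra_simps)
  qed (use insert.prems(2) m_eq in auto)
  then obtain c where c_sum: "\<And>v. m v - a * l k v = (\<Sum>i\<in>I. c i * l i v)" by blast
  have "m v = (\<Sum>i\<in>insert k I. (c(k := a)) i * l i v)" for v
  proof -
    have "(\<Sum>i\<in>I. (c(k := a)) i * l i v) = (\<Sum>i\<in>I. c i * l i v)"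
      using insert.hyps by (intro sum.cong) auto
    then show ?thesis using insert.hyps c_sum[of v] by simp
  qed
  then show ?case by blast
qed

definition norm_plus_evaluations ::
    "'v set \<Rightarrow> 'b::real_normed_vector \<times> ('v::real_normed_vector \<Rightarrow>\<^sub>L real) \<Rightarrow> real"
  where "norm_plus_evaluations F p = norm (fst p) + (\<Sum>f\<in>F. \<bar>blinfun_apply (snd p) f\<bar>)"

lemma sublinear_norm_plus_evaluations: "sublinear (norm_plus_evaluations F)"
proof (rule sublinearI)
  let ?q = "norm_plus_evaluations F"
  show "?q (p + r) \<le> ?q p + ?q r" for p r
  proof -
    have "(\<Sum>f\<in>F. \<bar>snd p f + snd r f\<bar>) \<le> (\<Sum>f\<in>F. \<bar>snd p f\<bar>) + (\<Sum>f\<in>F. \<bar>snd r f\<bar>)"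
      unfolding sum.distrib[symmetric] by (intro sum_mono abs_triangle_ineq)
    then show ?thesis
      using norm_triangle_ineq[of "fst p" "fst r"]
      by (simp add: norm_plus_evaluations_def blinfun.add_left)
  qed
  show "?q (t *\<^sub>R p) \<le> t * ?q p" if "0 < t" for t p
    using that
    by (simp add: norm_plus_evaluations_def blinfun.scaleR_left abs_mult sum_distrib_left
        distrib_left)
qed

lemma norm_plus_evaluations_less_imp:
  assumes "finite F" "norm_plus_evaluations F (v, \<psi>) < \<epsilon>"
  shows "norm v < \<epsilon>" and "f \<in> F \<Longrightarrow> \<bar>blinfun_apply \<psi> f\<bar> < \<epsilon>"
proof -
  have less: "norm v + (\<Sum>f\<in>F. \<bar>blinfun_apply \<psi> f\<bar>) < \<epsilon>"
    using assms(2) by (simp add: norm_plus_evaluations_def)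
  moreover have "0 \<le> (\<Sum>f\<in>F. \<bar>blinfun_apply \<psi> f\<bar>)" by (rule sum_nonneg) simp
  ultimately show "norm v < \<epsilon>" by linarith
  show "\<bar>blinfun_apply \<psi> f\<bar> < \<epsilon>" if "f \<in> F"
  proof -
    have "\<bar>blinfun_apply \<psi> f\<bar> \<le> (\<Sum>f\<in>F. \<bar>blinfun_apply \<psi> f\<bar>)"
      by (rule member_le_sum[OF that]) (auto simp: assms(1))
    with less norm_ge_zero[of v] show ?thesis by linarith
  qed
qed

lemma linear_le_norm_plus_evaluationsE:
  fixes l :: "'b::real_normed_vector \<times> ('v::real_normed_vector \<Rightarrow>\<^sub>L real) \<Rightarrow> real"
  assumes l: "linear l" "\<And>p. l p \<le> norm_plus_evaluations F p" and F: "finite F"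
  obtains g :: "'b \<Rightarrow>\<^sub>L real" and h :: 'v where "\<And>v \<psi>. l (v, \<psi>) = g v + blinfun_apply \<psi> h"
proof -
  have linear_components: "linear (\<lambda>v. l (v, 0))" "linear (\<lambda>\<psi>. l (0, \<psi>))"
    using linear_add[OF l(1)] linear_scale[OF l(1)]
    by (auto intro!: linearI; metis add.right_neutral add_Pair scaleR_Pair scaleR_zero_right)+
  have "l (v, 0) \<le> 1 * norm v" for v
    using l(2)[of "(v, 0)"] by (simp add: norm_plus_evaluations_def)
  then obtain g :: "'b \<Rightarrow>\<^sub>L real" where g: "\<And>v. g v = l (v, 0)"
    using linear_le_norm_imp_blinfun[OF linear_components(1)] zero_le_one by blast
  have "\<exists>c. \<forall>\<psi>. l (0, \<psi>) = (\<Sum>f\<in>F. c f * blinfun_apply \<psi> f)"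
  proof (rule linear_functional_eq_sum[OF F linear_components(2)])
    show "linear (\<lambda>\<psi>. blinfun_apply \<psi> f)" for f :: 'v
      by (rule linearI) (simp_all add: blinfun.bilinear_simps)
    fix \<psi> :: "'v \<Rightarrow>\<^sub>L real" assume "\<And>f. f \<in> F \<Longrightarrow> \<psi> f = 0"
    then show "l (0, \<psi>) = 0"
      using l(2)[of "(0, \<psi>)"] l(2)[of "(0, - \<psi>)"] linear_neg[OF l(1), of "(0, \<psi>)"]
      by (simp add: norm_plus_evaluations_def blinfun.minus_left)
  qed
  then obtain c where c_sum: "\<And>\<psi>. l (0, \<psi>) = (\<Sum>f\<in>F. c f * blinfun_apply \<psi> f)" by blast
  have "l (v, \<psi>) = g v + \<psi> (\<Sum>f\<in>F. c f *\<^sub>R f)" for v \<psi>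
    using linear_add[OF l(1), of "(v, 0)" "(0, \<psi>)"]
    by (simp add: g c_sum blinfun.sum_right blinfun.scaleR_right)
  then show thesis by (rule that)
qed

text \<open>Goldstine's theorem, strengthened: since \<open>T\<^sup>*\<^sup>* \<phi>\<close> lies in the target space, the approximating
  vector can be chosen with image close to it in norm.\<close>

theorem goldstine_bidual_op:
  fixes T :: "'a::real_normed_vector \<Rightarrow>\<^sub>L 'b::real_normed_vector"
  assumes y: "bidual_op T \<phi> = canon y" and F: "finite F" and \<epsilon>: "0 < \<epsilon>"
  shows "\<exists>x. norm x \<le> norm \<phi> \<and> norm (T x - y) < \<epsilon> \<and> (\<forall>f\<in>F. \<bar>blinfun_apply f x - \<phi> f\<bar> < \<epsilon>)"
proof (rule ccontr)
  assume no_approximation: "\<not> ?thesis"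
  let ?q = "norm_plus_evaluations F" and ?h = "\<lambda>x. (T x, canon x)"
  let ?K = "(\<lambda>x. ((y, \<phi>) - ?h x, \<epsilon>)) ` cball 0 (norm \<phi>)"
  have "linear ?h"
    by (rule linearI) (simp_all add: blinfun.bilinear_simps linear_add[OF linear_canon]
        linear_scale[OF linear_canon])
  then have "convex ?K"
    by (intro convex_image_diff_linear convex_cball)
  moreover have "\<epsilon> \<le> ?q ((y, \<phi>) - ?h x)" if "norm x \<le> norm \<phi>" for x
    using norm_plus_evaluations_less_imp[OF F, of "y - T x" "\<phi> - canon x" \<epsilon>] no_approximation that
    by (fastforce simp: norm_minus_commute abs_minus_commute blinfun.diff_left)
  then have "a \<le> ?q z" if "(z, a) \<in> ?K" for z a
    using that by auto
  ultimately obtain l where l: "linear l" "\<And>z. l z \<le> ?q z" "\<And>z a. (z, a) \<in> ?K \<Longrightarrow> a \<le> l z"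
    using mazur_orlicz[OF sublinear_norm_plus_evaluations, of ?K F] by blast
  obtain g :: "'b \<Rightarrow>\<^sub>L real" and h where gh: "\<And>v \<psi>. l (v, \<psi>) = g v + blinfun_apply \<psi> h"
    using linear_le_norm_plus_evaluationsE[OF l(1,2) F] by blast
  define k where "k = (g o\<^sub>L T) + h"
  have "\<phi> (g o\<^sub>L T) = g y"
    using arg_cong[OF y, of "\<lambda>\<psi>. blinfun_apply \<psi> g"] by simp
  then have "blinfun_apply k x \<le> \<phi> k - \<epsilon>" if "norm x \<le> norm \<phi>" for x
    using l(3)[of "(y, \<phi>) - ?h x" \<epsilon>] that by (simp add: gh k_def blinfun.bilinear_simps)
  then have "norm \<phi> * norm k \<le> \<phi> k - \<epsilon>"
    by (intro mult_norm_blinfun_le_if_le_on_cball) auto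
  also have "\<dots> < norm \<phi> * norm k"
    using norm_blinfun[of \<phi> k] \<epsilon> by simp
  finally show False by simp
qed

subsection \<open>Finite-dimensional subspaces\<close>

lemma subspace_dist_scaleR:
  fixes x :: "'a::real_normed_vector"
  assumes M: "subspace M" and d: "\<And>u. u \<in> M \<Longrightarrow> d \<le> norm (x - u)" and u: "u \<in> M"
  shows "\<bar>t\<bar> * d \<le> norm (t *\<^sub>R x + u)"
proof (cases "t = 0")
  case False
  have "d \<le> norm (x - (- 1 / t) *\<^sub>R u)"
    by (intro d subspace_scale[OF M] u)
  then have "\<bar>t\<bar> * d \<le> norm (t *\<^sub>R (x - (- 1 / t) *\<^sub>R u))"
    by (simp add: mult_left_mono)
  also have "t *\<^sub>R (x - (- 1 / t) *\<^sub>R u) = t *\<^sub>R x + u"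
    using False by (simp add: scaleR_add_right)
  finally show ?thesis .
qed auto

lemma closed_if_compact_Int_cball:
  fixes S :: "'a::real_normed_vector set"
  assumes "\<And>r. compact (S \<inter> cball 0 r)"
  shows "closed S"
  unfolding closed_sequential_limits
proof (intro allI impI, elim conjE)
  fix x l assume x: "\<forall>n. x n \<in> S" and lim: "x \<longlonglongrightarrow> l"
  then obtain r where "\<And>n. norm (x n) \<le> r"
    using convergent_imp_Bseq[of x] by (auto simp: Bseq_def convergent_def)
  with x have "\<forall>n. x n \<in> S \<inter> cball 0 r" by simp
  with lim compact_imp_closed[OF assms[of r]] have "l \<in> S \<inter> cball 0 r"
    unfolding closed_sequential_limits by blast
  then show "l \<in> S" by simp
qed

lemma compact_span_insert_Int_cball:
  fixes b :: "'a::real_normed_vector"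
  assumes B: "\<And>r. compact (span B \<inter> cball 0 r)" and b: "b \<notin> span B"
  shows "compact (span (insert b B) \<inter> cball 0 r)"
proof -
  define d where "d = infdist b (span B)"
  have "span B \<noteq> {}" using span_zero by blast
  then have d: "0 < d"
    unfolding d_def using b closed_if_compact_Int_cball[OF B]
    by (simp add: infdist_pos_not_in_closed)
  have d_le: "\<bar>t\<bar> * d \<le> norm (t *\<^sub>R b + u)" if "u \<in> span B" for t u
    using that infdist_le[of _ "span B" b]
    by (intro subspace_dist_scaleR[of "span B"]) (auto simp: d_def dist_norm)
  let ?g = "\<lambda>(t, u). t *\<^sub>R b + u"
  let ?P = "{- (r / d)..r / d} \<times> (span B \<inter> cball 0 (r + r / d * norm b))"
  have "span (insert b B) \<inter> cball 0 r = ?g ` ?P \<inter> cball 0 r"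
  proof (intro equalityI subsetI)
    fix x assume x: "x \<in> span (insert b B) \<inter> cball 0 r"
    then obtain t u where u: "u \<in> span B" and x_eq: "x = t *\<^sub>R b + u"
      by (auto simp: span_insert) (metis add.commute diff_add_cancel)
    have "\<bar>t\<bar> * d \<le> r" using d_le[OF u, of t] x by (simp add: x_eq)
    then have t: "\<bar>t\<bar> \<le> r / d" using d by (simp add: field_simps)
    have "norm u \<le> norm x + \<bar>t\<bar> * norm b"
      using norm_triangle_ineq4[of x "t *\<^sub>R b"] by (simp add: x_eq)
    also have "\<dots> \<le> r + r / d * norm b" using x t by (intro add_mono mult_right_mono) auto
    finally have "(t, u) \<in> ?P" using t u by (auto simp: abs_le_iff)
    with x x_eq show "x \<in> ?g ` ?P \<inter> cball 0 r" by auto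
  next
    fix x assume "x \<in> ?g ` ?P \<inter> cball 0 r"
    then show "x \<in> span (insert b B) \<inter> cball 0 r"
      by (auto intro!: span_add span_scale intro: span_base span_mono[THEN subsetD, of B])
  qed
  moreover have "compact (?g ` ?P)"
    by (intro compact_continuous_image compact_Times B compact_Icc)
       (auto simp: case_prod_beta intro!: continuous_intros)
  ultimately show ?thesis by (simp add: compact_Int_closed)
qed

lemma compact_span_Int_cball:
  fixes B :: "'a::real_normed_vector set"
  assumes "finite B"
  shows "compact (span B \<inter> cball 0 r)"
  using assms
proof (induction B arbitrary: r rule: finite_induct)
  case empty
  then show ?case by (simp add: finite_imp_compact)
next
  case (insert b B)
  then show ?case
    using compact_span_insert_Int_cball[of B b]
    by (cases "b \<in> span B") (simp_all add: span_redundant)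
qed

lemma compact_span_Int_sphere:
  fixes B :: "'a::real_normed_vector set"
  assumes "finite B"
  shows "compact (span B \<inter> sphere 0 1)"
proof -
  have "closed (sphere (0::'a) 1)"
    unfolding sphere_def by (intro closed_Collect_eq continuous_intros)
  with compact_span_Int_cball[OF assms, of 1] have "compact ((span B \<inter> cball 0 1) \<inter> sphere 0 1)"
    by (rule compact_Int_closed)
  moreover have "(span B \<inter> cball 0 1) \<inter> sphere 0 1 = span B \<inter> sphere (0::'a) 1" by auto
  ultimately show ?thesis by simp
qed

definition almost_norms :: "real \<Rightarrow> 'v::real_normed_vector set \<Rightarrow> ('v \<Rightarrow>\<^sub>L real) set \<Rightarrow> bool" where
  "almost_norms \<epsilon> F E \<longleftrightarrow> (\<forall>f\<in>F. norm f \<le> 1) \<and>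
     (\<forall>e\<in>E. \<exists>f\<in>F. (1 - \<epsilon>) * norm e \<le> blinfun_apply e f)"

lemma ex_finite_almost_norming:
  fixes E :: "('v::real_normed_vector \<Rightarrow>\<^sub>L real) set"
  assumes E: "compact E" "E \<subseteq> sphere 0 1" and \<epsilon>: "0 < \<epsilon>"
  obtains F where "finite F" "almost_norms \<epsilon> F E"
proof -
  let ?U = "\<lambda>f. {e :: 'v \<Rightarrow>\<^sub>L real. 1 - \<epsilon> < blinfun_apply e f}"
  have "E \<subseteq> (\<Union>f\<in>cball 0 1. ?U f)"
  proof (rule ccontr)
    assume "\<not> ?thesis"
    then obtain e where e: "e \<in> E" "\<And>f. norm f \<le> 1 \<Longrightarrow> blinfun_apply e f \<le> 1 - \<epsilon>"
      by (auto simp: not_less subset_iff)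
    have "norm e \<le> 1 - \<epsilon>" using mult_norm_blinfun_le_if_le_on_cball[of 1 e] e(2) by simp
    with e(1) E(2) \<epsilon> show False by auto
  qed
  moreover have "open (?U f)" for f
    by (intro open_Collect_less continuous_intros)
  ultimately obtain F where F: "F \<subseteq> cball 0 1" "finite F" "E \<subseteq> (\<Union>f\<in>F. ?U f)"
    using compactE_image[OF E(1), of "cball 0 1" ?U] by (metis (lifting))
  have "almost_norms \<epsilon> F E"
    unfolding almost_norms_def
  proof (intro conjI ballI)
    show "norm f \<le> 1" if "f \<in> F" for f using F(1) that by auto
    fix e assume e: "e \<in> E"
    then obtain f where "f \<in> F" "1 - \<epsilon> < blinfun_apply e f" using F(3) by blast
    moreover have "norm e = 1" using e E(2) by auto
    ultimately show "\<exists>f\<in>F. (1 - \<epsilon>) * norm e \<le> blinfun_apply e f" by force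
  qed
  with F(2) that show thesis by blast
qed

lemma ex_finite_almost_norming_span:
  fixes B :: "('v::real_normed_vector \<Rightarrow>\<^sub>L real) set"
  assumes B: "finite B" and \<epsilon>: "0 < \<epsilon>"
  obtains F where "finite F" "almost_norms \<epsilon> F (span B)"
proof -
  obtain F where F: "finite F" "almost_norms \<epsilon> F (span B \<inter> sphere 0 1)"
    using ex_finite_almost_norming[OF compact_span_Int_sphere[OF B] _ \<epsilon>] by auto
  have "\<exists>f\<in>insert 0 F. (1 - \<epsilon>) * norm e \<le> blinfun_apply e f" if e: "e \<in> span B" for e
  proof (cases "e = 0")
    case False
    then have "sgn e \<in> span B \<inter> sphere 0 1"
      using e by (simp add: sgn_div_norm span_scale norm_sgn)
    then obtain f where "f \<in> F" "1 - \<epsilon> \<le> blinfun_apply (sgn e) f"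
      using F(2) unfolding almost_norms_def by fastforce
    then show ?thesis
      using False by (intro bexI[of _ f]) (auto simp: sgn_div_norm blinfun.scaleR_left field_simps)
  qed auto
  then have "almost_norms \<epsilon> (insert 0 F) (span B)"
    using F(2) by (simp add: almost_norms_def)
  with F(1) that show thesis by blast
qed

definition almost_orthogonal :: "real \<Rightarrow> 'v::real_normed_vector set \<Rightarrow> 'v \<Rightarrow> bool" where
  "almost_orthogonal \<epsilon> E w \<longleftrightarrow> (\<forall>e\<in>E. \<forall>t. (1 - \<epsilon>) * norm e \<le> norm (e + t *\<^sub>R w))"

lemma almost_orthogonal_if_small_on_almost_norming:
  fixes E :: "('v::real_normed_vector \<Rightarrow>\<^sub>L real) set"
  assumes F: "almost_norms \<epsilon> F E" and \<epsilon>: "0 \<le> \<epsilon>"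
    and small: "\<And>f. f \<in> F \<Longrightarrow> \<bar>blinfun_apply w f\<bar> \<le> \<epsilon> * norm w"
  shows "almost_orthogonal (3 * \<epsilon>) E w"
  unfolding almost_orthogonal_def
proof (intro ballI allI)
  fix e t assume e: "e \<in> E"
  show "(1 - 3 * \<epsilon>) * norm e \<le> norm (e + t *\<^sub>R w)"
  proof (cases "norm (t *\<^sub>R w) \<le> 2 * norm e")
    case True
    obtain f where f: "f \<in> F" "(1 - \<epsilon>) * norm e \<le> blinfun_apply e f" "norm f \<le> 1"
      using F e unfolding almost_norms_def by blast
    have "\<bar>t * blinfun_apply w f\<bar> \<le> \<bar>t\<bar> * (\<epsilon> * norm w)"
      using small[OF f(1)] by (simp add: abs_mult mult_left_mono)
    also have "\<dots> = \<epsilon> * norm (t *\<^sub>R w)" by simp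
    also have "\<dots> \<le> \<epsilon> * (2 * norm e)" by (rule mult_left_mono[OF True \<epsilon>])
    finally have "(1 - 3 * \<epsilon>) * norm e \<le> blinfun_apply (e + t *\<^sub>R w) f"
      using f(2) by (simp add: blinfun.bilinear_simps algebra_simps)
    also have "\<dots> \<le> norm (e + t *\<^sub>R w) * norm f"
      using norm_blinfun[of "e + t *\<^sub>R w" f] by simp
    also have "\<dots> \<le> norm (e + t *\<^sub>R w)"
      using f(3) by (simp add: mult_right_le_one_le)
    finally show ?thesis .
  next
    case False
    have "(1 - 3 * \<epsilon>) * norm e \<le> norm e" using \<epsilon> by (simp add: left_diff_distrib)
    also have "\<dots> \<le> norm (t *\<^sub>R w) - norm e" using False by simp
    also have "\<dots> \<le> norm (e + t *\<^sub>R w)"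
      using norm_triangle_ineq4[of "e + t *\<^sub>R w" e] by simp
    finally show ?thesis .
  qed
qed

lemma ex_approximation_almost_orthogonal:
  fixes T :: "'a::real_normed_vector \<Rightarrow>\<^sub>L 'b::real_normed_vector"
  assumes y: "bidual_op T \<phi> = canon y" and d: "0 < d" "\<And>x. d \<le> norm (\<phi> - canon x)"
    and B: "finite B" and \<epsilon>: "0 < \<epsilon>" and \<eta>: "0 < \<eta>"
  shows "\<exists>x. (norm x \<le> norm \<phi> \<and> norm (T x - y) \<le> \<eta>) \<and>
    almost_orthogonal \<epsilon> (span B) (canon x - \<phi>)"
proof -
  obtain F where F: "finite F" "almost_norms (\<epsilon> / 3) F (span B)"
    using ex_finite_almost_norming_span[OF B, of "\<epsilon> / 3"] \<epsilon> by auto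
  define \<delta> where "\<delta> = min \<eta> (\<epsilon> / 3 * d)"
  have "0 < \<delta>" using d(1) \<epsilon> \<eta> by (simp add: \<delta>_def)
  then obtain x where x: "norm x \<le> norm \<phi>" "norm (T x - y) < \<delta>"
    "\<And>f. f \<in> F \<Longrightarrow> \<bar>blinfun_apply f x - \<phi> f\<bar> < \<delta>"
    using goldstine_bidual_op[OF y F(1)] by blast
  let ?w = "canon x - \<phi>"
  have "\<delta> \<le> \<epsilon> / 3 * norm ?w"
  proof -
    have "\<delta> \<le> \<epsilon> / 3 * d" by (simp add: \<delta>_def)
    also have "\<dots> \<le> \<epsilon> / 3 * norm ?w"
      using d(2)[of x] \<epsilon> by (intro mult_left_mono) (auto simp: norm_minus_commute)
    finally show ?thesis .
  qed
  then have "\<bar>blinfun_apply ?w f\<bar> \<le> \<epsilon> / 3 * norm ?w" if "f \<in> F" for f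
    using x(3)[OF that] unfolding blinfun.diff_left canon_apply by linarith
  then have "almost_orthogonal \<epsilon> (span B) ?w"
    using almost_orthogonal_if_small_on_almost_norming[OF F(2), of ?w] \<epsilon> by simp
  moreover have "norm (T x - y) \<le> \<eta>" using x(2) by (simp add: \<delta>_def)
  ultimately show ?thesis using x(1) by blast
qed

subsection \<open>Zabreiko's lemma and uniform boundedness\<close>

lemma ex_ball_subset_closure_if_subset_UNION:
  fixes S :: "'a::complete_space set" and E :: "nat \<Rightarrow> 'a set"
  assumes S: "closed S" "S \<noteq> {}" and cover: "S \<subseteq> (\<Union>n. E n)"
  shows "\<exists>n. \<exists>z\<in>S. \<exists>r>0. ball z r \<inter> S \<subseteq> closure (E n)"
proof -
  have "\<exists>n. (top_of_set S) interior_of (S \<inter> closure (E n)) \<noteq> {}"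
  proof (rule ccontr)
    assume contra: "\<not> ?thesis"
    have "(top_of_set S) interior_of (\<Union>n. S \<inter> closure (E n)) = {}"
    proof (rule Baire_category_alt)
      show "completely_metrizable_space (top_of_set S) \<or>
          locally_compact_space (top_of_set S) \<and> regular_space (top_of_set S)"
        using S(1)
          completely_metrizable_space_closedin[OF completely_metrizable_space_euclidean, of S]
        by simp
    qed (use contra in \<open>auto simp: closedin_closed_Int\<close>)
    moreover have "(\<Union>n. S \<inter> closure (E n)) = S"
      using cover closure_subset by blast
    ultimately show False
      using S(2) by (metis interior_of_topspace topspace_euclidean_subtopology)
  qed
  then obtain n U z where U: "openin (top_of_set S) U" "z \<in> U" "U \<subseteq> closure (E n)"
    by (auto simp: interior_of_def)
  then obtain r where "0 < r" "ball z r \<inter> S \<subseteq> U"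
    by (meson openin_contains_ball)
  moreover have "z \<in> S" using U(1,2) openin_imp_subset by blast
  ultimately show ?thesis using U(3) by blast
qed

lemma ex_half_approximation_series:
  fixes h :: "'a::real_normed_vector \<Rightarrow> 'a"
  assumes Z: "subspace Z" and h: "\<And>z. z \<in> Z \<Longrightarrow> h z \<in> Z" "\<And>z. z \<in> Z \<Longrightarrow> norm (z - h z) \<le> norm z / 2"
    and z: "z \<in> Z"
  shows "\<exists>v. (\<forall>k. v k \<in> Z \<and> norm (v k) \<le> norm z * (1/2) ^ k) \<and> (\<lambda>k. h (v k)) sums z"
proof (intro exI conjI allI)
  define v where "v k = ((\<lambda>u. u - h u) ^^ k) z" for k
  have v_0: "v 0 = z" and v_Suc: "v (Suc k) = v k - h (v k)" for k by (simp_all add: v_def)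
  show v_in: "v k \<in> Z" for k
    by (induction k) (auto simp: v_0 v_Suc z intro: subspace_diff[OF Z] h(1))
  show norm_v: "norm (v k) \<le> norm z * (1/2) ^ k" for k
  proof (induction k)
    case (Suc k)
    then show ?case using h(2)[OF v_in, of k] by (simp add: v_Suc)
  qed (simp add: v_0)
  have "(\<lambda>k. norm z * (1/2) ^ k) \<longlonglongrightarrow> 0"
    by (intro tendsto_mult_right_zero LIMSEQ_power_zero) simp
  then have "v \<longlonglongrightarrow> 0"
    by (rule Lim_null_comparison[OF always_eventually[OF allI[OF norm_v]]])
  from telescope_sums'[OF this] show "(\<lambda>k. h (v k)) sums z"
    by (simp add: v_0 v_Suc)
qed

locale countably_subadditive_seminorm =
  fixes Z :: "'a::banach set" and p :: "'a \<Rightarrow> real"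
  assumes subspace_Z: "subspace Z" and closed_Z: "closed Z"
    and scaleR_le: "\<And>t z. z \<in> Z \<Longrightarrow> p (t *\<^sub>R z) \<le> \<bar>t\<bar> * p z"
    and countably_subadditive: "\<And>y z. (\<And>i. y i \<in> Z) \<Longrightarrow> y sums z \<Longrightarrow> summable (\<lambda>i. p (y i)) \<Longrightarrow>
      p z \<le> (\<Sum>i. p (y i))"
begin

lemma p_zero: "p 0 = 0"
  using scaleR_le[of 0 0] scaleR_le[of 0 2] subspace_0[OF subspace_Z] by simp

lemma p_add_le:
  assumes "u \<in> Z" "v \<in> Z"
  shows "p (u + v) \<le> p u + p v"
proof -
  let ?y = "\<lambda>i::nat. if i = 0 then u else if i = 1 then v else 0"
  have "?y sums (\<Sum>i\<in>{0, 1}. ?y i)" "(\<lambda>i. p (?y i)) sums (\<Sum>i\<in>{0, 1}. p (?y i))"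
    by (rule sums_finite; auto simp: p_zero)+
  then show ?thesis
    using countably_subadditive[of ?y "u + v"] assms subspace_0[OF subspace_Z]
    by (auto simp: sums_iff)
qed

lemma p_diff_le: "u \<in> Z \<Longrightarrow> v \<in> Z \<Longrightarrow> p (u - v) \<le> p u + p v"
  using p_add_le[of u "- v"] scaleR_le[of v "- 1"] subspace_neg[OF subspace_Z, of v] by simp

lemma p_nonneg: "u \<in> Z \<Longrightarrow> 0 \<le> p u"
  using p_diff_le[of u u] p_zero by simp

lemma half_approximation_if_ball_subset_closure:
  assumes z0: "z0 \<in> Z" and r: "0 < r" "ball z0 r \<inter> Z \<subseteq> closure {u \<in> Z. p u \<le> K}"
    and z: "z \<in> Z" "z \<noteq> 0"
  shows "\<exists>y\<in>Z. p y \<le> 4 * K / r * norm z \<and> norm (z - y) \<le> norm z / 2"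
proof -
  define s where "s = r / (2 * norm z)"
  have s: "0 < s" "s * norm z = r / 2" using r(1) z(2) by (auto simp: s_def)
  have "z0 + s *\<^sub>R z \<in> closure {u \<in> Z. p u \<le> K}" "z0 \<in> closure {u \<in> Z. p u \<le> K}"
    using r(1) s z(1) z0 by (auto intro!: subsetD[OF r(2)] subspace_add[OF subspace_Z]
        subspace_scale[OF subspace_Z] simp: dist_norm)
  moreover have "0 < r / 8" using r(1) by simp
  ultimately obtain u v where uv: "u \<in> Z" "p u \<le> K" "v \<in> Z" "p v \<le> K"
    and near: "norm (u - (z0 + s *\<^sub>R z)) < r / 8" "norm (v - z0) < r / 8"
    unfolding closure_approachable dist_norm by blast
  show ?thesis
  proof (intro bexI[of _ "(1 / s) *\<^sub>R (u - v)"] conjI)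
    have "p ((1 / s) *\<^sub>R (u - v)) \<le> (1 / s) * p (u - v)"
      using scaleR_le[of "u - v" "1 / s"] s uv by (simp add: subspace_diff[OF subspace_Z])
    also have "\<dots> \<le> (1 / s) * (2 * K)"
      using p_diff_le[OF uv(1,3)] uv(2,4) s by (intro mult_left_mono) auto
    also have "\<dots> = 4 * K / r * norm z" using r(1) z(2) by (simp add: s_def)
    finally show "p ((1 / s) *\<^sub>R (u - v)) \<le> 4 * K / r * norm z" .
    have "s *\<^sub>R (z - (1 / s) *\<^sub>R (u - v)) = (v - z0) - (u - (z0 + s *\<^sub>R z))"
      using s by (simp add: scaleR_diff_right)
    then have "s * norm (z - (1 / s) *\<^sub>R (u - v)) = norm ((v - z0) - (u - (z0 + s *\<^sub>R z)))"
      using s by (metis abs_of_pos norm_scaleR)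
    also have "\<dots> \<le> s * (norm z / 2)"
      using near s(2) norm_triangle_ineq4[of "v - z0" "u - (z0 + s *\<^sub>R z)"] by simp
    finally show "norm (z - (1 / s) *\<^sub>R (u - v)) \<le> norm z / 2"
      by (rule mult_left_le_imp_le[OF _ s(1)])
    show "(1 / s) *\<^sub>R (u - v) \<in> Z"
      by (intro subspace_scale[OF subspace_Z] subspace_diff[OF subspace_Z] uv)
  qed
qed

lemma ex_bounded_half_approximation:
  "\<exists>L\<ge>0. \<forall>z\<in>Z. \<exists>y\<in>Z. p y \<le> L * norm z \<and> norm (z - y) \<le> norm z / 2"
proof -
  have "Z \<noteq> {}" using subspace_0[OF subspace_Z] by auto
  moreover have "Z \<subseteq> (\<Union>K. {u \<in> Z. p u \<le> real K})" using real_arch_simple by auto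
  ultimately obtain K z0 r where
    ball: "z0 \<in> Z" "0 < r" "ball z0 r \<inter> Z \<subseteq> closure {u \<in> Z. p u \<le> real K}"
    using ex_ball_subset_closure_if_subset_UNION[OF closed_Z] by blast
  have "\<exists>y\<in>Z. p y \<le> 4 * real K / r * norm z \<and> norm (z - y) \<le> norm z / 2" if "z \<in> Z" for z
  proof (cases "z = 0")
    case True
    with that show ?thesis by (intro bexI[of _ 0]) (simp_all add: p_zero)
  next
    case False
    then show ?thesis by (rule half_approximation_if_ball_subset_closure[OF ball that])
  qed
  moreover have "0 \<le> 4 * real K / r" using ball(2) by simp
  ultimately show ?thesis by blast
qed

theorem zabreiko: "\<exists>C\<ge>0. \<forall>z\<in>Z. p z \<le> C * norm z"
proof -
  obtain L where L: "0 \<le> L"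
    and "\<forall>z\<in>Z. \<exists>y\<in>Z. p y \<le> L * norm z \<and> norm (z - y) \<le> norm z / 2"
    using ex_bounded_half_approximation by blast
  then obtain h where h: "\<And>z. z \<in> Z \<Longrightarrow> h z \<in> Z" "\<And>z. z \<in> Z \<Longrightarrow> p (h z) \<le> L * norm z"
    "\<And>z. z \<in> Z \<Longrightarrow> norm (z - h z) \<le> norm z / 2"
    by metis
  have "p z \<le> 2 * L * norm z" if z: "z \<in> Z" for z
  proof -
    obtain v where v: "\<And>k. v k \<in> Z" "\<And>k. norm (v k) \<le> norm z * (1/2) ^ k" "(\<lambda>k. h (v k)) sums z"
      using ex_half_approximation_series[OF subspace_Z h(1,3) z] by blast
    have p_le: "p (h (v k)) \<le> L * norm z * (1/2) ^ k" for k
      using h(2)[OF v(1), of k] mult_left_mono[OF v(2) L, of k] by (simp add: mult.assoc)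
    have geometric: "(\<lambda>k. L * norm z * (1/2) ^ k) sums (L * norm z * 2)"
      using sums_mult[OF geometric_sums[of "1/2::real"], of "L * norm z"] by simp
    have summable: "summable (\<lambda>k. p (h (v k)))"
      using p_le p_nonneg[OF h(1)[OF v(1)]]
      by (intro summable_comparison_test'[OF sums_summable[OF geometric]]) simp
    have "p z \<le> (\<Sum>k. p (h (v k)))"
      using v(1,3) summable by (intro countably_subadditive h(1))
    also have "\<dots> \<le> L * norm z * 2"
      using suminf_le[OF p_le summable sums_summable[OF geometric]] geometric
      by (simp add: sums_iff)
    finally show ?thesis by simp
  qed
  then show ?thesis using L by (intro exI[of _ "2 * L"]) auto
qed

end

theorem pointwise_bounded_imp_uniformly_bounded:
  fixes S :: "'i \<Rightarrow> 'a::banach \<Rightarrow> 'b::banach"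
  assumes Z: "subspace Z" "closed Z"
    and bdd: "\<And>z. z \<in> Z \<Longrightarrow> bdd_above (range (\<lambda>i. norm (S i z)))"
    and scaleR: "\<And>i t z. z \<in> Z \<Longrightarrow> S i (t *\<^sub>R z) = t *\<^sub>R S i z"
    and sums: "\<And>i y z. (\<And>k. y k \<in> Z) \<Longrightarrow> y sums z \<Longrightarrow> summable (\<lambda>k. SUP i. norm (S i (y k))) \<Longrightarrow>
      (\<lambda>k. S i (y k)) sums S i z"
  shows "\<exists>C\<ge>0. \<forall>z\<in>Z. \<forall>i. norm (S i z) \<le> C * norm z"
proof -
  define p where "p z = (SUP i. norm (S i z))" for z
  have upper: "norm (S i z) \<le> p z" if "z \<in> Z" for i z
    unfolding p_def by (rule cSUP_upper[OF UNIV_I bdd[OF that]])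
  interpret countably_subadditive_seminorm Z p
  proof
    show "p (t *\<^sub>R z) \<le> \<bar>t\<bar> * p z" if "z \<in> Z" for t z
      unfolding p_def[of "t *\<^sub>R z"]
      by (rule cSUP_least) (simp_all add: scaleR[OF that] mult_left_mono upper[OF that])
    show "p z \<le> (\<Sum>k. p (y k))"
      if y: "\<And>k. y k \<in> Z" and "y sums z" and summable: "summable (\<lambda>k. p (y k))" for y z
      unfolding p_def[of z]
    proof (rule cSUP_least)
      fix i
      have "(\<lambda>k. S i (y k)) sums S i z"
        using sums[OF y \<open>y sums z\<close>] summable by (simp add: p_def)
      from norm_sums_le[OF this summable_sums[OF summable]] y
      show "norm (S i z) \<le> (\<Sum>k. p (y k))" by (simp add: upper)
    qed simp
  qed (rule Z)+
  obtain C where "0 \<le> C" "\<And>z. z \<in> Z \<Longrightarrow> p z \<le> C * norm z"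
    using zabreiko by blast
  then show ?thesis using upper order_trans by blast
qed

subsection \<open>Closed spans and biorthogonal functionals\<close>

lemma subspace_closure:
  fixes M :: "'a::real_normed_vector set"
  assumes M: "subspace M"
  shows "subspace (closure M)"
proof (rule subspaceI)
  show "0 \<in> closure M" using subspace_0[OF M] closure_subset by blast
  have "(\<lambda>(x, y). x + y) ` closure (M \<times> M) \<subseteq> closure M"
    by (rule image_closure_subset)
       (auto simp: case_prod_beta
          intro!: continuous_intros closure_subset[THEN subsetD] subspace_add[OF M])
  then show "x + y \<in> closure M" if "x \<in> closure M" "y \<in> closure M" for x y
    using that by (auto simp: closure_Times)
  have "(*\<^sub>R) t ` closure M \<subseteq> closure M" for t
    by (rule image_closure_subset)
       (auto intro!: continuous_intros closure_subset[THEN subsetD] subspace_scale[OF M])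
  then show "t *\<^sub>R x \<in> closure M" if "x \<in> closure M" for t x
    using that by auto
qed

abbreviation closed_span :: "(nat \<Rightarrow> 'a::real_normed_vector) \<Rightarrow> 'a set" where
  "closed_span b \<equiv> closure (span (range b))"

lemma sum_in_span_range: "(\<Sum>j<n. c j *\<^sub>R b j) \<in> span (range b)"
  by (intro span_sum span_scale span_base) auto

lemma sum_in_closed_span: "(\<Sum>j<n. c j *\<^sub>R b j) \<in> closed_span b"
  using sum_in_span_range closure_subset by blast

lemma sums_in_closed_span:
  assumes "(\<lambda>j. c j *\<^sub>R b j) sums z"
  shows "z \<in> closed_span b"
  unfolding closure_sequential
  using assms sum_in_span_range[of c b]
  by (intro exI[of _ "\<lambda>n. \<Sum>j<n. c j *\<^sub>R b j"]) (simp add: sums_def)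

lemma in_span_rangeE:
  fixes b :: "nat \<Rightarrow> 'a::real_vector"
  assumes "v \<in> span (range b)"
  obtains c :: "nat \<Rightarrow> real" and N where "\<And>n. N \<le> n \<Longrightarrow> (\<Sum>j<n. c j *\<^sub>R b j) = v"
proof -
  have "\<exists>(c::nat \<Rightarrow> real) N. \<forall>n\<ge>N. (\<Sum>j<n. c j *\<^sub>R b j) = v"
    using assms
  proof (induction rule: span_induct_alt)
    case base
    then show ?case by (intro exI[of _ "\<lambda>_. 0"]) simp
  next
    case (step t x y)
    then obtain i c N where "x = b i" and c_sum: "\<And>n. N \<le> n \<Longrightarrow> (\<Sum>j<n. c j *\<^sub>R b j) = y" by blast
    have "(\<Sum>j<n. (of_bool (j = i) * t + c j) *\<^sub>R b j) = t *\<^sub>R x + y" if n: "max N (Suc i) \<le> n" for n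
    proof -
      have "(\<Sum>j<n. (of_bool (j = i) * t) *\<^sub>R b j) = t *\<^sub>R b i"
        by (subst sum.mono_neutral_right[of _ "{i}"]) (use n in auto)
      then show ?thesis using n by (simp add: scaleR_add_left sum.distrib c_sum \<open>x = b i\<close>)
    qed
    then show ?case
      by (intro exI[of _ "\<lambda>j. of_bool (j = i) * t + c j"] exI[of _ "max N (Suc i)"]) simp
  qed
  with that show thesis by blast
qed

definition dominates ::
    "real \<Rightarrow> (nat \<Rightarrow> 'a::real_normed_vector) \<Rightarrow> (nat \<Rightarrow> 'b::real_normed_vector) \<Rightarrow> bool"
  where "dominates K b d \<longleftrightarrow> 0 \<le> K \<and>
    (\<forall>(c::nat \<Rightarrow> real) n. norm (\<Sum>j<n. c j *\<^sub>R d j) \<le> K * norm (\<Sum>j<n. c j *\<^sub>R b j))"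

lemma ex_blinfun_if_dominates:
  fixes b :: "nat \<Rightarrow> 'a::real_normed_vector" and a :: "nat \<Rightarrow> real"
  assumes "dominates K b a"
  shows "\<exists>f :: 'a \<Rightarrow>\<^sub>L real. \<forall>j. f (b j) = a j"
proof -
  let ?G = "span (range (\<lambda>j. (b j, a j)))"
  have "s \<le> K * norm z" if zs: "(z, s) \<in> ?G" for z s
  proof -
    obtain c :: "nat \<Rightarrow> real" and n where "(\<Sum>j<n. c j *\<^sub>R (b j, a j)) = (z, s)"
      using in_span_rangeE[OF zs] by blast
    then have "z = (\<Sum>j<n. c j *\<^sub>R b j)" "s = (\<Sum>j<n. c j *\<^sub>R a j)"
      by (auto simp: prod_eq_iff fst_sum snd_sum)
    moreover have "norm (\<Sum>j<n. c j *\<^sub>R a j) \<le> K * norm (\<Sum>j<n. c j *\<^sub>R b j)"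
      using assms unfolding dominates_def by blast
    ultimately show ?thesis by simp
  qed
  then obtain f :: "'a \<Rightarrow>\<^sub>L real" where f: "\<And>z s. (z, s) \<in> ?G \<Longrightarrow> s \<le> f z"
    using mazur_orlicz_blinfun[OF subspace_imp_convex[OF subspace_span],
        of "range (\<lambda>j. (b j, a j))" K] assms
    unfolding dominates_def by blast
  have "f (b j) = a j" for j
    using f[of "b j" "a j"] f[of "- b j" "- a j"] span_neg[of "(b j, a j)"]
    by (simp add: span_base blinfun.minus_right)
  then show ?thesis by blast
qed

lemma sums_if_less:
  "(\<lambda>j. (if j < n then c j else 0) *\<^sub>R b j) sums (\<Sum>j<n. c j *\<^sub>R (b j :: 'a::real_normed_vector))"
proof -
  have "(\<lambda>j. (if j < n then c j else 0) *\<^sub>R b j) sums (\<Sum>j<n. (if j < n then c j else 0) *\<^sub>R b j)"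
    by (rule sums_finite) auto
  then show ?thesis by simp
qed

definition biorthogonal :: "(nat \<Rightarrow> 'a::real_normed_vector \<Rightarrow>\<^sub>L real) \<Rightarrow> (nat \<Rightarrow> 'a) \<Rightarrow> bool" where
  "biorthogonal f b \<longleftrightarrow> (\<forall>i j. blinfun_apply (f i) (b j) = of_bool (i = j))"

lemma biorthogonal_sums:
  assumes f: "biorthogonal f b" and z: "(\<lambda>j. c j *\<^sub>R b j) sums z"
  shows "f i z = c i"
proof -
  have "(\<lambda>j. f i (c j *\<^sub>R b j)) sums f i z"
    by (rule bounded_linear.sums[OF blinfun.bounded_linear_right z])
  moreover have "(\<lambda>j. f i (c j *\<^sub>R b j)) = (\<lambda>j. if j = i then c j else 0)"
    using f by (auto simp: biorthogonal_def blinfun.scaleR_right)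
  ultimately show ?thesis using sums_single[of i c] sums_unique2 by metis
qed

lemma biorthogonal_sum:
  assumes "biorthogonal f b" "i < n"
  shows "f i (\<Sum>j<n. c j *\<^sub>R b j) = c i"
  using biorthogonal_sums[OF assms(1) sums_if_less, of i c n] assms(2) by simp

subsection \<open>Basis constants\<close>

definition basis_constant_le :: "real \<Rightarrow> (nat \<Rightarrow> 'a::real_normed_vector) \<Rightarrow> bool" where
  "basis_constant_le C b \<longleftrightarrow> 0 \<le> C \<and> (\<forall>(c::nat \<Rightarrow> real) n m. n \<le> m \<longrightarrow>
     norm (\<Sum>j<n. c j *\<^sub>R b j) \<le> C * norm (\<Sum>j<m. c j *\<^sub>R b j))"

lemma basis_constant_leD:
  fixes c :: "nat \<Rightarrow> real"
  shows "basis_constant_le C b \<Longrightarrow> n \<le> m \<Longrightarrow> norm (\<Sum>j<n. c j *\<^sub>R b j) \<le> C * norm (\<Sum>j<m. c j *\<^sub>R b j)"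
  by (simp add: basis_constant_le_def)

lemma basis_constant_le_imp_dominates_coordinate:
  fixes b :: "nat \<Rightarrow> 'a::real_normed_vector"
  assumes C: "basis_constant_le C b" and "b i \<noteq> 0"
  shows "dominates (2 * C / norm (b i)) b (\<lambda>j. of_bool (i = j) :: real)"
  unfolding dominates_def
proof (intro conjI allI)
  show "0 \<le> 2 * C / norm (b i)" using C by (simp add: basis_constant_le_def)
  fix c :: "nat \<Rightarrow> real" and n
  let ?v = "norm (\<Sum>j<n. c j *\<^sub>R b j)"
  show "norm (\<Sum>j<n. c j *\<^sub>R of_bool (i = j) :: real) \<le> 2 * C / norm (b i) * ?v"
  proof (cases "i < n")
    case True
    have "\<bar>c i\<bar> * norm (b i) = norm ((\<Sum>j<Suc i. c j *\<^sub>R b j) - (\<Sum>j<i. c j *\<^sub>R b j))" by simp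
    also have "\<dots> \<le> C * ?v + C * ?v"
      using True
      by (intro order_trans[OF norm_triangle_ineq4] add_mono basis_constant_leD[OF C]) auto
    finally have "\<bar>c i\<bar> \<le> 2 * C / norm (b i) * ?v"
      using \<open>b i \<noteq> 0\<close> by (simp add: field_simps)
    moreover have "(\<Sum>j<n. c j *\<^sub>R of_bool (i = j)) = c i"
      using True by (simp add: of_bool_def if_distrib cong: if_cong)
    ultimately show ?thesis by simp
  next
    case False
    then have "(\<Sum>j<n. c j *\<^sub>R of_bool (i = j) :: real) = 0" by (intro sum.neutral) auto
    with C show ?thesis by (simp add: basis_constant_le_def)
  qed
qed

lemma basis_constant_le_imp_ex_biorthogonal:
  assumes "basis_constant_le C b" "\<And>j. b j \<noteq> 0"
  shows "\<exists>f. biorthogonal f b"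
  unfolding biorthogonal_def
  using ex_blinfun_if_dominates[OF basis_constant_le_imp_dominates_coordinate[OF assms]]
  by (intro choice allI)

lemma norm_biorthogonal_sum_le:
  assumes C: "basis_constant_le C b" and f: "biorthogonal f b" and z: "z \<in> closed_span b"
  shows "norm (\<Sum>j<n. f j z *\<^sub>R b j) \<le> C * norm z"
proof -
  let ?S = "{z. norm (\<Sum>j<n. f j z *\<^sub>R b j) \<le> C * norm z}"
  have "span (range b) \<subseteq> ?S"
  proof
    fix z assume "z \<in> span (range b)"
    then obtain c N where c_sum: "\<And>m. N \<le> m \<Longrightarrow> (\<Sum>j<m. c j *\<^sub>R b j) = z"
      using in_span_rangeE by blast
    define m where "m = max N n"
    have m: "z = (\<Sum>j<m. c j *\<^sub>R b j)" "n \<le> m" by (auto simp: m_def c_sum)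
    have "(\<Sum>j<n. f j z *\<^sub>R b j) = (\<Sum>j<n. c j *\<^sub>R b j)"
      using m by (intro sum.cong) (auto simp: biorthogonal_sum[OF f])
    then show "z \<in> ?S" using basis_constant_leD[OF C m(2), of c] m(1) by simp
  qed
  moreover have "closed ?S" by (intro closed_Collect_le continuous_intros)
  ultimately show ?thesis using z closure_minimal by blast
qed

lemma basis_constant_le_imp_expansion:
  assumes C: "basis_constant_le C b" and f: "biorthogonal f b" and z: "z \<in> closed_span b"
  shows "(\<lambda>j. f j z *\<^sub>R b j) sums z"
  unfolding sums_def
proof (rule LIMSEQ_I)
  let ?P = "\<lambda>n z. \<Sum>j<n. f j z *\<^sub>R b j"
  have C_nonneg: "0 \<le> C" using C by (simp add: basis_constant_le_def)
  fix e :: real assume "0 < e"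
  then have "0 < e / (C + 1)" using C_nonneg by simp
  then obtain q where q: "q \<in> span (range b)" "norm (q - z) < e / (C + 1)"
    using z unfolding closure_approachable dist_norm by blast
  obtain c N where c_sum: "\<And>n. N \<le> n \<Longrightarrow> (\<Sum>j<n. c j *\<^sub>R b j) = q"
    using in_span_rangeE[OF q(1)] by blast
  show "\<exists>N. \<forall>n\<ge>N. norm (?P n z - z) < e"
  proof (intro exI allI impI)
    fix n assume n: "N \<le> n"
    have "?P n q = (\<Sum>j<n. c j *\<^sub>R b j)"
      by (intro sum.cong) (auto simp: biorthogonal_sum[OF f] simp flip: c_sum[OF n])
    then have "?P n z - z = (q - z) - ?P n (q - z)"
      by (simp add: c_sum[OF n] blinfun.diff_right scaleR_diff_left sum_subtractf)
    also have "norm \<dots> \<le> norm (q - z) + C * norm (q - z)"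
      using q(1) z closure_subset[of "span (range b)"]
      by (intro order_trans[OF norm_triangle_ineq4] add_left_mono norm_biorthogonal_sum_le[OF C f]
          subspace_diff[OF subspace_closure[OF subspace_span]]) auto
    also have "\<dots> = (C + 1) * norm (q - z)" by (simp add: algebra_simps)
    also have "\<dots> < e" using q(2) C_nonneg by (simp add: field_simps)
    finally show "norm (?P n z - z) < e" .
  qed
qed

theorem basis_constant_le_imp_basic_seq:
  assumes C: "basis_constant_le C b" and nonzero: "\<And>j. b j \<noteq> 0"
  shows "basic_seq b"
proof -
  obtain f where f: "biorthogonal f b"
    using basis_constant_le_imp_ex_biorthogonal[OF assms] by blast
  show ?thesis
    unfolding basic_seq_def
  proof (intro ballI ex1I)
    fix z assume "z \<in> closed_span b"
    then show "(\<lambda>j. f j z *\<^sub>R b j) sums z" by (rule basis_constant_le_imp_expansion[OF C f])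
    show "c = (\<lambda>j. f j z)" if "(\<lambda>j. c j *\<^sub>R b j) sums z" for c
      using biorthogonal_sums[OF f that] by (simp add: fun_eq_iff)
  qed
qed

definition basis_coeff :: "(nat \<Rightarrow> 'a::real_normed_vector) \<Rightarrow> 'a \<Rightarrow> nat \<Rightarrow> real" where
  "basis_coeff b z = (THE c. (\<lambda>j. c j *\<^sub>R b j) sums z)"

context
  fixes b :: "nat \<Rightarrow> 'a::real_normed_vector"
  assumes b: "basic_seq b"
begin

lemma basis_coeff_sums:
  assumes "z \<in> closed_span b"
  shows "(\<lambda>j. basis_coeff b z j *\<^sub>R b j) sums z"
  unfolding basis_coeff_def by (rule theI'[OF bspec[OF b[unfolded basic_seq_def] assms]])

lemma basis_coeff_eqI: "(\<lambda>j. c j *\<^sub>R b j) sums z \<Longrightarrow> basis_coeff b z = c"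
  using b basis_coeff_sums sums_in_closed_span unfolding basic_seq_def by blast

lemma basis_coeff_scaleR:
  "z \<in> closed_span b \<Longrightarrow> basis_coeff b (t *\<^sub>R z) = (\<lambda>j. t * basis_coeff b z j)"
  using sums_scaleR_right[OF basis_coeff_sums, of z t] by (intro basis_coeff_eqI) simp

lemma basis_coeff_sum: "basis_coeff b (\<Sum>j<n. c j *\<^sub>R b j) = (\<lambda>j. if j < n then c j else 0)"
  by (rule basis_coeff_eqI[OF sums_if_less])

lemma basic_seq_nonzero: "b j \<noteq> 0"
proof
  assume "b j = 0"
  then have "(\<lambda>i. of_bool (i = j) *\<^sub>R b i) = (\<lambda>_. 0)" by auto
  then have "basis_coeff b 0 = (\<lambda>i. of_bool (i = j))" by (intro basis_coeff_eqI) simp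
  then have "basis_coeff b 0 j = 1" by simp
  moreover have "basis_coeff b 0 j = 0" using basis_coeff_eqI[of "\<lambda>_. 0" 0] by simp
  ultimately show False by simp
qed

end

lemma basis_coeff_countably_additive:
  fixes b :: "nat \<Rightarrow> 'a::banach"
  assumes b: "basic_seq b" and y: "\<And>k. y k \<in> closed_span b" "y sums z"
    and M: "\<And>k n. norm (\<Sum>j<n. basis_coeff b (y k) j *\<^sub>R b j) \<le> M k" "summable M"
  shows "(\<lambda>k. basis_coeff b (y k) i) sums basis_coeff b z i"
proof -
  let ?P = "\<lambda>k n. \<Sum>j<n. basis_coeff b (y k) j *\<^sub>R b j"
  define e where "e j = (\<Sum>k. basis_coeff b (y k) j)" for j
  have e: "(\<lambda>k. basis_coeff b (y k) j) sums e j" for j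
    unfolding e_def
  proof (rule summable_sums, rule summable_comparison_test')
    show "summable (\<lambda>k. 2 * M k / norm (b j))" using M(2) by (intro summable_divide summable_mult)
    fix k :: nat
    have "\<bar>basis_coeff b (y k) j\<bar> * norm (b j) = norm (?P k (Suc j) - ?P k j)" by simp
    also have "\<dots> \<le> M k + M k"
      by (intro order_trans[OF norm_triangle_ineq4] add_mono M(1))
    finally show "norm (basis_coeff b (y k) j) \<le> 2 * M k / norm (b j)"
      using basic_seq_nonzero[OF b, of j] by (simp add: field_simps)
  qed
  have P_sums: "(\<lambda>k. ?P k n) sums (\<Sum>j<n. e j *\<^sub>R b j)" for n
    by (intro sums_sum sums_scaleR_left e)
  have "(\<lambda>n. \<Sum>k. ?P k n) \<longlonglongrightarrow> z"
  proof (rule swap_uniform_limit')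
    show "uniform_limit UNIV (\<lambda>K n. \<Sum>k<K. ?P k n) (\<lambda>n. \<Sum>k. ?P k n) sequentially"
      by (rule Weierstrass_m_test[OF M])
    show "\<forall>\<^sub>F K in sequentially. (\<lambda>n. \<Sum>k<K. ?P k n) \<longlonglongrightarrow> (\<Sum>k<K. y k)"
      using basis_coeff_sums[OF b y(1)]
      by (intro always_eventually allI tendsto_sum) (simp add: sums_def)
    show "(\<lambda>K. \<Sum>k<K. y k) \<longlonglongrightarrow> z" using y(2) by (simp add: sums_def)
  qed auto
  then have "(\<lambda>j. e j *\<^sub>R b j) sums z"
    by (simp add: sums_def sums_unique[OF P_sums])
  then have "basis_coeff b z = e" by (rule basis_coeff_eqI[OF b])
  with e show ?thesis by simp
qed

lemma bdd_above_norm_partial_sums: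
  fixes x :: "nat \<Rightarrow> 'a::real_normed_vector"
  assumes "summable x"
  shows "bdd_above (range (\<lambda>n. norm (\<Sum>j<n. x j)))"
proof -
  have "Bseq (\<lambda>n. \<Sum>j<n. x j)"
    using assms by (intro convergent_imp_Bseq) (simp add: summable_iff_convergent)
  then obtain K where "\<And>n. norm (\<Sum>j<n. x j) \<le> K" by (auto simp: Bseq_def)
  then show ?thesis by (intro bdd_aboveI2)
qed

theorem basic_seq_imp_basis_constant_le:
  fixes b :: "nat \<Rightarrow> 'a::banach"
  assumes b: "basic_seq b"
  shows "\<exists>C. basis_constant_le C b"
proof -
  let ?S = "\<lambda>n z. \<Sum>j<n. basis_coeff b z j *\<^sub>R b j"
  have bdd: "bdd_above (range (\<lambda>n. norm (?S n z)))" if "z \<in> closed_span b" for z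
    by (rule bdd_above_norm_partial_sums[OF sums_summable[OF basis_coeff_sums[OF b that]]])
  have "\<exists>C\<ge>0. \<forall>z\<in>closed_span b. \<forall>n. norm (?S n z) \<le> C * norm z"
  proof (rule pointwise_bounded_imp_uniformly_bounded[OF _ _ bdd])
    show "?S n (t *\<^sub>R z) = t *\<^sub>R ?S n z" if "z \<in> closed_span b" for n t z
      by (simp add: basis_coeff_scaleR[OF b that] scaleR_sum_right)
    show "(\<lambda>k. ?S n (y k)) sums ?S n z"
      if y: "\<And>k. y k \<in> closed_span b" "y sums z"
        and "summable (\<lambda>k. SUP n. norm (?S n (y k)))" for n y z
    proof (intro sums_sum sums_scaleR_left basis_coeff_countably_additive[OF b y _ that(3)])
      show "norm (?S m (y k)) \<le> (SUP n. norm (?S n (y k)))" for m k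
        by (rule cSUP_upper[OF UNIV_I bdd[OF y(1)]])
    qed
  qed (simp_all add: subspace_closure)
  then obtain C where C: "0 \<le> C" "\<And>z n. z \<in> closed_span b \<Longrightarrow> norm (?S n z) \<le> C * norm z"
    by blast
  have "norm (\<Sum>j<n. c j *\<^sub>R b j) \<le> C * norm (\<Sum>j<m. c j *\<^sub>R b j)" if "n \<le> m" for c n m
  proof -
    have "?S n (\<Sum>j<m. c j *\<^sub>R b j) = (\<Sum>j<n. c j *\<^sub>R b j)"
      unfolding basis_coeff_sum[OF b] using that by (intro sum.cong) auto
    with C(2)[OF sum_in_closed_span[of c b m], of n] show ?thesis by simp
  qed
  with C(1) show ?thesis by (auto simp: basis_constant_le_def)
qed

lemma basic_seq_imp_ex_biorthogonal:
  fixes b :: "nat \<Rightarrow> 'a::banach"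
  assumes "basic_seq b"
  shows "\<exists>f. biorthogonal f b"
  using basic_seq_imp_basis_constant_le[OF assms] basic_seq_nonzero[OF assms]
    basis_constant_le_imp_ex_biorthogonal by blast

lemma basic_seq_expansion:
  assumes "basic_seq b" "biorthogonal f b" "z \<in> closed_span b"
  shows "(\<lambda>j. f j z *\<^sub>R b j) sums z"
proof -
  have "f j z = basis_coeff b z j" for j
    by (rule biorthogonal_sums[OF assms(2) basis_coeff_sums[OF assms(1,3)]])
  then show ?thesis using basis_coeff_sums[OF assms(1,3)] by simp
qed

theorem basic_seq_imp_dominates:
  fixes b :: "nat \<Rightarrow> 'a::banach" and d :: "nat \<Rightarrow> 'b::banach"
  assumes b: "basic_seq b"
    and summable: "\<And>c :: nat \<Rightarrow> real. summable (\<lambda>j. c j *\<^sub>R b j) \<Longrightarrow> summable (\<lambda>j. c j *\<^sub>R d j)"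
  shows "\<exists>K. dominates K b d"
proof -
  obtain f where f: "biorthogonal f b"
    using basic_seq_imp_ex_biorthogonal[OF b] by blast
  let ?S = "\<lambda>n z. \<Sum>j<n. f j z *\<^sub>R d j"
  have "\<exists>K\<ge>0. \<forall>z\<in>closed_span b. \<forall>n. norm (?S n z) \<le> K * norm z"
  proof (rule pointwise_bounded_imp_uniformly_bounded)
    show "bdd_above (range (\<lambda>n. norm (?S n z)))" if "z \<in> closed_span b" for z
      using basic_seq_expansion[OF b f that]
      by (intro bdd_above_norm_partial_sums summable sums_summable)
    show "?S n (t *\<^sub>R z) = t *\<^sub>R ?S n z" for n t z
      by (simp add: blinfun.scaleR_right scaleR_sum_right)
    show "(\<lambda>k. ?S n (y k)) sums ?S n z" if "y sums z" for n y z
      by (intro sums_sum sums_scaleR_left bounded_linear.sums[OF blinfun.bounded_linear_right that])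
  qed (simp_all add: subspace_closure)
  then obtain K where K: "0 \<le> K" "\<And>z n. z \<in> closed_span b \<Longrightarrow> norm (?S n z) \<le> K * norm z"
    by blast
  have "norm (\<Sum>j<n. c j *\<^sub>R d j) \<le> K * norm (\<Sum>j<n. c j *\<^sub>R b j)" for c n
    using K(2)[OF sum_in_closed_span[of c b n], of n] by (simp add: biorthogonal_sum[OF f])
  with K(1) show ?thesis by (auto simp: dominates_def)
qed

subsection \<open>Wide sequences\<close>

lemma semi_normalizedI:
  assumes lower: "\<And>j. 1 \<le> K * norm (b j)" and upper: "\<And>j. norm (b j) \<le> M"
  shows "semi_normalized b"
proof -
  have "0 < K * norm (b 0)" using lower[of 0] by linarith
  then have "0 < K" by (simp add: zero_less_mult_iff)
  moreover from this have "1 / K \<le> norm (b j)" for j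
    using lower[of j] by (simp add: field_simps)
  ultimately have "\<exists>a>0. \<forall>j. a \<le> norm (b j)" by (intro exI[of _ "1 / K"]) simp
  with upper show ?thesis unfolding semi_normalized_def by blast
qed

lemma one_le_norm_mult_norm_if_apply_eq_one:
  fixes s :: "'a::real_normed_vector \<Rightarrow>\<^sub>L real"
  shows "s x = 1 \<Longrightarrow> 1 \<le> norm s * norm x"
  using norm_blinfun[of s x] by simp

lemma wide_sI:
  fixes x :: "nat \<Rightarrow> 'a::banach" and s :: "'a \<Rightarrow>\<^sub>L real"
  assumes C: "basis_constant_le C x" and s: "\<And>j. s (x j) = 1"
    and bound: "\<And>j. norm (x j) \<le> M"
  shows "wide_s x"
  unfolding wide_s_def
proof (intro conjI allI impI)
  show "semi_normalized x"
    by (rule semi_normalizedI[OF one_le_norm_mult_norm_if_apply_eq_one[OF s] bound])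
  have "x j \<noteq> 0" for j using s[of j] by force
  then show "basic_seq x" by (rule basis_constant_le_imp_basic_seq[OF C])
  fix c :: "nat \<Rightarrow> real" assume "summable (\<lambda>j. c j *\<^sub>R x j)"
  then have "summable (\<lambda>j. s (c j *\<^sub>R x j))"
    by (rule bounded_linear.summable[OF blinfun.bounded_linear_right])
  then show "summable c" by (simp add: blinfun.scaleR_right s)
qed

lemma wide_s_imp_ex_functional:
  fixes x :: "nat \<Rightarrow> 'a::banach"
  assumes "wide_s x"
  shows "\<exists>s :: 'a \<Rightarrow>\<^sub>L real. \<forall>j. s (x j) = 1"
proof -
  obtain K where "dominates K x (\<lambda>_. 1::real)"
    using basic_seq_imp_dominates[of x "\<lambda>_. 1::real"] assms unfolding wide_s_def by auto
  then show ?thesis by (rule ex_blinfun_if_dominates)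
qed

lemma basis_constant_le_differences:
  fixes x :: "nat \<Rightarrow> 'a::real_normed_vector" and s :: "'a \<Rightarrow>\<^sub>L real"
  assumes C: "basis_constant_le C x" and s: "\<And>j. s (x j) = 1"
    and bound: "\<And>j. norm (x j) \<le> M"
  shows "basis_constant_le ((1 + norm s * M) * C) (\<lambda>j. x (Suc j) - x j)"
  unfolding basis_constant_le_def
proof (intro conjI allI impI)
  have M: "0 \<le> M" using bound[of 0] norm_ge_zero order_trans by blast
  then show "0 \<le> (1 + norm s * M) * C" using C by (simp add: basis_constant_le_def)
  fix c :: "nat \<Rightarrow> real" and n m :: nat assume nm: "n \<le> m"
  let ?e = "\<lambda>j. x (Suc j) - x j"
  define a where "a j = (if j < m then c j else 0)" for j
  define p where "p j = (case j of 0 \<Rightarrow> 0 | Suc i \<Rightarrow> a i) - a j" for j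
  have by_parts: "(\<Sum>j<k. a j *\<^sub>R ?e j) = (\<Sum>j<Suc k. p j *\<^sub>R x j) + a k *\<^sub>R x k" for k
    by (induction k) (simp_all add: p_def algebra_simps)
  have a_sum: "(\<Sum>j<k. a j *\<^sub>R ?e j) = (\<Sum>j<k. c j *\<^sub>R ?e j)" if "k \<le> m" for k
    using that by (intro sum.cong) (auto simp: a_def)
  define w where "w = (\<Sum>j<Suc n. p j *\<^sub>R x j)"
  have "s (\<Sum>j<n. a j *\<^sub>R ?e j) = 0"
    by (simp add: blinfun.sum_right blinfun.scaleR_right blinfun.diff_right s)
  then have "a n = - s w"
    by (simp add: by_parts w_def blinfun.add_right blinfun.scaleR_right s del: sum.lessThan_Suc)
  then have "norm (\<Sum>j<n. c j *\<^sub>R ?e j) = norm (w - s w *\<^sub>R x n)"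
    using by_parts[of n] a_sum[OF nm] by (simp add: w_def)
  also have "\<dots> \<le> norm w + norm s * norm w * M"
    using norm_triangle_ineq4[of w "s w *\<^sub>R x n"] mult_mono[OF norm_blinfun[of s w] bound[of n]]
    by simp
  also have "\<dots> = (1 + norm s * M) * norm w" by (simp add: algebra_simps)
  also have "\<dots> \<le> (1 + norm s * M) * (C * norm (\<Sum>j<Suc m. p j *\<^sub>R x j))"
    unfolding w_def using nm M by (intro mult_left_mono basis_constant_leD[OF C]) auto
  also have "(\<Sum>j<Suc m. p j *\<^sub>R x j) = (\<Sum>j<m. c j *\<^sub>R ?e j)"
    using by_parts[of m] a_sum[of m] by (simp add: a_def del: sum.lessThan_Suc)
  finally show "norm (\<Sum>j<n. c j *\<^sub>R ?e j) \<le> (1 + norm s * M) * C * norm (\<Sum>j<m. c j *\<^sub>R ?e j)"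
    by (simp only: mult.assoc)
qed

lemma norm_le_norm_difference:
  assumes C: "basis_constant_le C x"
  shows "norm (x j) \<le> C * norm (x (Suc j) - x j)"
proof -
  define c :: "nat \<Rightarrow> real" where "c i = of_bool (i = Suc j) - of_bool (i = j)" for i
  have "(\<Sum>i<j. c i *\<^sub>R x i) = 0" by (intro sum.neutral) (auto simp: c_def)
  then have "(\<Sum>i<Suc j. c i *\<^sub>R x i) = - x j" "(\<Sum>i<Suc (Suc j). c i *\<^sub>R x i) = x (Suc j) - x j"
    by (simp_all add: c_def)
  with basis_constant_leD[OF C, of "Suc j" "Suc (Suc j)" c] show ?thesis
    by (simp del: sum.lessThan_Suc)
qed

lemma wide_c_differences:
  fixes x :: "nat \<Rightarrow> 'a::banach" and s :: "'a \<Rightarrow>\<^sub>L real"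
  assumes C: "basis_constant_le C x" and s: "\<And>j. s (x j) = 1"
    and bound: "\<And>j. norm (x j) \<le> M"
  shows "wide_c (\<lambda>j. x (Suc j) - x j)"
proof -
  let ?e = "\<lambda>j. x (Suc j) - x j"
  have norm_diff: "norm (x k - x l) \<le> 2 * M" for k l
    using norm_triangle_ineq4[of "x k" "x l"] bound[of k] bound[of l] by linarith
  have lower: "1 \<le> norm s * C * norm (?e j)" for j
    using one_le_norm_mult_norm_if_apply_eq_one[OF s, of j]
      mult_left_mono[OF norm_le_norm_difference[OF C, of j], of "norm s"]
    by (simp add: mult.assoc)
  have "semi_normalized ?e" by (rule semi_normalizedI[OF lower norm_diff])
  moreover have "?e j \<noteq> 0" for j using lower[of j] by force
  then have "basic_seq ?e"
    by (rule basis_constant_le_imp_basic_seq[OF basis_constant_le_differences[OF assms]])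
  ultimately show ?thesis
    unfolding wide_c_def sum_lessThan_telescope using norm_diff by blast
qed

subsection \<open>Operators with wide sequences are not Tauberian\<close>

lemma tauberian_imp_ex_weak_limit:
  fixes T :: "'a::real_normed_vector \<Rightarrow>\<^sub>L 'b::real_normed_vector"
  assumes T: "tauberian T" and bound: "\<And>n. norm (x n) \<le> M" and lim: "(\<lambda>n. T (x n)) \<longlonglongrightarrow> y"
    and V: "subspace V" "\<And>n. x n \<in> V"
  shows "\<exists>u\<in>closure V. \<forall>(f :: 'a \<Rightarrow>\<^sub>L real) r. (\<lambda>n. f (x n)) \<longlonglongrightarrow> r \<longrightarrow> f u = r"
proof -
  obtain \<phi> :: "('a \<Rightarrow>\<^sub>L real) \<Rightarrow>\<^sub>L real" where
    \<phi>: "\<And>f r. (\<lambda>n. blinfun_apply f (x n)) \<longlonglongrightarrow> r \<Longrightarrow> \<phi> f = r"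
    using ex_bidual_extending_limits[of sequentially x M, OF sequentially_bot bound] by blast
  have "bidual_op T \<phi> = canon y"
  proof (rule blinfun_eqI)
    fix g :: "'b \<Rightarrow>\<^sub>L real"
    have "(\<lambda>n. (g o\<^sub>L T) (x n)) \<longlonglongrightarrow> g y"
      using blinfun.tendsto[OF tendsto_const lim, of g] by simp
    from \<phi>[OF this] show "bidual_op T \<phi> g = canon y g" by simp
  qed
  with T obtain u where "\<phi> = canon u" unfolding tauberian_def by blast
  with \<phi> have u: "f u = r" if "(\<lambda>n. f (x n)) \<longlonglongrightarrow> r" for f :: "'a \<Rightarrow>\<^sub>L real" and r
    using that by simp
  have "u \<in> closure V"
    using u V(2) by (intro in_closure_subspaceI[OF V(1)]) simp
  with u show ?thesis by blast
qed

lemma wide_s_imp_not_tauberian: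
  fixes T :: "'a::banach \<Rightarrow>\<^sub>L 'b::real_normed_vector"
  assumes x: "wide_s x" and "convergent (\<lambda>j. T (x j))"
  shows "\<not> tauberian T"
proof
  assume T: "tauberian T"
  obtain M where M: "\<And>n. norm (x n) \<le> M" and basic: "basic_seq x"
    using x unfolding wide_s_def semi_normalized_def by blast
  obtain y where lim: "(\<lambda>n. T (x n)) \<longlonglongrightarrow> y" using assms(2) by (auto simp: convergent_def)
  have "x n \<in> span (range x)" for n by (simp add: span_base)
  then obtain u where u: "u \<in> closed_span x"
    "\<And>(f :: 'a \<Rightarrow>\<^sub>L real) r. (\<lambda>n. f (x n)) \<longlonglongrightarrow> r \<Longrightarrow> f u = r"
    using tauberian_imp_ex_weak_limit[OF T M lim subspace_span] by blast
  obtain f where f: "biorthogonal f x"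
    using basic_seq_imp_ex_biorthogonal[OF basic] by blast
  have "f k u = 0" for k
  proof (rule u(2), rule tendsto_eventually, rule eventually_sequentiallyI[of "Suc k"])
    show "f k (x n) = 0" if "Suc k \<le> n" for n
      using f that by (simp add: biorthogonal_def)
  qed
  then have "u = 0"
    using basic_seq_expansion[OF basic f u(1)] by (simp add: sums_iff)
  obtain s :: "'a \<Rightarrow>\<^sub>L real" where "\<And>j. s (x j) = 1"
    using wide_s_imp_ex_functional[OF x] by blast
  then have "s u = 1" by (intro u(2)) simp
  with \<open>u = 0\<close> show False by simp
qed

lemma wide_c_imp_not_tauberian:
  fixes T :: "'a::banach \<Rightarrow>\<^sub>L 'b::banach"
  assumes e: "wide_c e" and summable: "summable (\<lambda>j. norm (T (e j)))"
  shows "\<not> tauberian T"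
proof
  assume T: "tauberian T"
  obtain M a where M: "\<And>n. norm (\<Sum>j<n. e j) \<le> M" and a: "0 < a" "\<And>j. a \<le> norm (e j)"
    and basic: "basic_seq e"
    using e unfolding wide_c_def semi_normalized_def by blast
  have lim: "(\<lambda>n. T (\<Sum>j<n. e j)) \<longlonglongrightarrow> (\<Sum>j. T (e j))"
    using summable_LIMSEQ[OF summable_norm_cancel[OF summable]] by (simp add: blinfun.sum_right)
  have "(\<Sum>j<n. e j) \<in> span (range e)" for n
    by (intro span_sum span_base) simp
  then obtain u where u: "u \<in> closed_span e"
    "\<And>(f :: 'a \<Rightarrow>\<^sub>L real) r. (\<lambda>n. f (\<Sum>j<n. e j)) \<longlonglongrightarrow> r \<Longrightarrow> f u = r"
    using tauberian_imp_ex_weak_limit[OF T M lim subspace_span] by blast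
  obtain f where f: "biorthogonal f e"
    using basic_seq_imp_ex_biorthogonal[OF basic] by blast
  have "f k u = 1" for k
  proof (rule u(2), rule tendsto_eventually, rule eventually_sequentiallyI[of "Suc k"])
    show "f k (\<Sum>j<n. e j) = 1" if "Suc k \<le> n" for n
      using biorthogonal_sum[OF f, of k n "\<lambda>_. 1"] that by simp
  qed
  then have "e sums u"
    using basic_seq_expansion[OF basic f u(1)] by simp
  then have "e \<longlonglongrightarrow> 0" by (intro summable_LIMSEQ_zero sums_summable)
  then obtain j where "norm (e j) < a" using LIMSEQ_D[of e 0 a] a(1) by auto
  with a(2)[of j] show False by simp
qed

subsection \<open>Non-Tauberian operators have wide sequences\<close>

text \<open>The product of the factors \<open>1 - \<epsilon>\<^sub>n = g (Suc n) / g n\<close> telescopes, so it stays above \<open>1 / C\<close>.\<close>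

lemma basis_constant_le_if_almost_orthogonal:
  fixes b :: "nat \<Rightarrow> 'a::real_normed_vector"
  assumes g: "\<And>n. 1 \<le> g n" "\<And>n. g n \<le> C"
    and orthogonal: "\<And>n. almost_orthogonal (1 - g (Suc n) / g n) (span (b ` {..<n})) (b n)"
  shows "basis_constant_le C b"
  unfolding basis_constant_le_def
proof (intro conjI allI impI)
  show "0 \<le> C" using g[of 0] by linarith
  fix c :: "nat \<Rightarrow> real" and n m :: nat assume "n \<le> m"
  let ?S = "\<lambda>k. norm (\<Sum>j<k. c j *\<^sub>R b j)"
  have S_Suc: "g (Suc k) * ?S k \<le> g k * ?S (Suc k)" for k
  proof -
    have "(\<Sum>j<k. c j *\<^sub>R b j) \<in> span (b ` {..<k})"
      by (intro span_sum span_scale span_base) simp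
    then have "g (Suc k) / g k * ?S k \<le> ?S (Suc k)"
      using orthogonal[of k] by (simp add: almost_orthogonal_def)
    then show ?thesis using g(1)[of k] by (simp add: field_simps)
  qed
  have "g m * ?S n \<le> g n * ?S m"
    using \<open>n \<le> m\<close>
  proof (induction m rule: dec_induct)
    case (step m)
    have "g m * (g (Suc m) * ?S n) \<le> g (Suc m) * (g n * ?S m)"
      using mult_left_mono[OF step.IH, of "g (Suc m)"] g(1)[of "Suc m"]
      by (simp add: mult.left_commute)
    also have "\<dots> \<le> g m * (g n * ?S (Suc m))"
      using mult_left_mono[OF S_Suc[of m], of "g n"] g(1)[of n] by (simp only: mult_ac)
    finally show ?case by (rule mult_left_le_imp_le) (use g(1)[of m] in linarith)
  qed simp
  moreover have "1 * ?S n \<le> g m * ?S n" "g n * ?S m \<le> C * ?S m"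
    by (intro mult_right_mono g norm_ge_zero)+
  ultimately show "?S n \<le> C * ?S m" by linarith
qed

context
  fixes \<phi> :: "'v::real_normed_vector" and x :: "nat \<Rightarrow> 'v" and C d :: real and V :: "'v set"
  assumes C: "basis_constant_le C (case_nat \<phi> (\<lambda>j. x j - \<phi>))"
    and V: "subspace V" "\<And>j. x j \<in> V" and d: "0 < d" "\<And>u. u \<in> V \<Longrightarrow> d \<le> norm (\<phi> - u)"
begin

lemma norm_sum_add_tail_le:
  fixes c :: "nat \<Rightarrow> real"
  assumes "n \<le> m"
  shows "norm ((\<Sum>j<n. c j *\<^sub>R x j) + (sum c {..<m} - sum c {..<n}) *\<^sub>R \<phi>)
    \<le> C * norm (\<Sum>j<m. c j *\<^sub>R x j)"
proof -
  have "(\<Sum>i<Suc k. case_nat (sum c {..<m}) c i *\<^sub>R case_nat \<phi> (\<lambda>j. x j - \<phi>) i)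
      = (\<Sum>j<k. c j *\<^sub>R x j) + (sum c {..<m} - sum c {..<k}) *\<^sub>R \<phi>" for k
    by (simp add: sum.lessThan_Suc_shift scaleR_diff_right scaleR_diff_left sum_subtractf
        scaleR_sum_left del: sum.lessThan_Suc)
  then show ?thesis
    using basis_constant_leD[OF C, of "Suc n" "Suc m" "case_nat (sum c {..<m}) c"] assms
    by (simp del: sum.lessThan_Suc)
qed

lemma abs_tail_le:
  fixes c :: "nat \<Rightarrow> real"
  assumes "n \<le> m"
  shows "\<bar>sum c {..<m} - sum c {..<n}\<bar> \<le> C / d * norm (\<Sum>j<m. c j *\<^sub>R x j)"
proof -
  have "\<bar>sum c {..<m} - sum c {..<n}\<bar> * d
      \<le> norm ((sum c {..<m} - sum c {..<n}) *\<^sub>R \<phi> + (\<Sum>j<n. c j *\<^sub>R x j))"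
    by (intro subspace_dist_scaleR[OF V(1) d(2)] subspace_sum[OF V(1)] subspace_scale[OF V(1)] V(2))
  also have "\<dots> \<le> C * norm (\<Sum>j<m. c j *\<^sub>R x j)"
    using norm_sum_add_tail_le[OF assms, of c] by (simp add: add.commute)
  finally show ?thesis using d(1) by (simp add: field_simps)
qed

lemma dominates_one_if_basis_constant_le_shift: "dominates (C / d) x (\<lambda>_. 1::real)"
  unfolding dominates_def
proof (intro conjI allI)
  show "0 \<le> C / d" using C d(1) by (simp add: basis_constant_le_def)
  show "norm (\<Sum>j<n. c j *\<^sub>R (1::real)) \<le> C / d * norm (\<Sum>j<n. c j *\<^sub>R x j)" for c n
    using abs_tail_le[of 0 n c] by simp
qed

lemma basis_constant_le_if_basis_constant_le_shift: "basis_constant_le (C + C / d * norm \<phi>) x"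
  unfolding basis_constant_le_def
proof (intro conjI allI impI)
  show "0 \<le> C + C / d * norm \<phi>" using C d(1) by (simp add: basis_constant_le_def)
  fix c :: "nat \<Rightarrow> real" and n m :: nat assume nm: "n \<le> m"
  let ?v = "norm (\<Sum>j<m. c j *\<^sub>R x j)" and ?t = "sum c {..<m} - sum c {..<n}"
  have "norm (\<Sum>j<n. c j *\<^sub>R x j) \<le> norm ((\<Sum>j<n. c j *\<^sub>R x j) + ?t *\<^sub>R \<phi>) + norm (?t *\<^sub>R \<phi>)"
    using norm_triangle_ineq4[of "(\<Sum>j<n. c j *\<^sub>R x j) + ?t *\<^sub>R \<phi>" "?t *\<^sub>R \<phi>"] by simp
  also have "\<dots> \<le> C * ?v + C / d * ?v * norm \<phi>"
    using norm_sum_add_tail_le[OF nm, of c]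
      mult_right_mono[OF abs_tail_le[OF nm, of c], of "norm \<phi>"] by simp
  finally show "norm (\<Sum>j<n. c j *\<^sub>R x j) \<le> (C + C / d * norm \<phi>) * ?v"
    by (simp add: algebra_simps)
qed

end

lemma ex_strictly_decreasing_between:
  fixes C :: real
  assumes "1 < C"
  shows "\<exists>g. \<forall>n. 1 \<le> g n \<and> g n \<le> C \<and> g (Suc n) < g n"
proof (intro exI allI)
  fix n
  have "(C - 1) * (1/2) ^ n \<le> C - 1"
    using assms by (intro mult_left_le power_le_one) auto
  then show "1 \<le> 1 + (C - 1) * (1/2) ^ n \<and> 1 + (C - 1) * (1/2) ^ n \<le> C \<and>
      1 + (C - 1) * (1/2) ^ Suc n < 1 + (C - 1) * (1/2) ^ n"
    using assms by (auto simp: le_diff_eq add.commute)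
qed

lemma ex_selection_basis_constant_le:
  fixes \<phi> :: "'v::real_normed_vector" and h :: "'a \<Rightarrow> 'v" and Q :: "nat \<Rightarrow> 'a \<Rightarrow> bool"
  assumes ex_orthogonal:
      "\<And>n B \<epsilon>. finite B \<Longrightarrow> 0 < \<epsilon> \<Longrightarrow> \<exists>z. Q n z \<and> almost_orthogonal \<epsilon> (span B) (h z)"
    and "1 < C"
  shows "\<exists>x. (\<forall>n. Q n (x n)) \<and> basis_constant_le C (case_nat \<phi> (\<lambda>j. h (x j)))"
proof -
  obtain g where g: "\<And>n. 1 \<le> g n" "\<And>n. g n \<le> C" "\<And>n. g (Suc n) < g n"
    using ex_strictly_decreasing_between[OF \<open>1 < C\<close>] by blast
  define \<epsilon> where "\<epsilon> n = 1 - g (Suc n) / g n" for n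
  have \<epsilon>: "0 < \<epsilon> n" for n using g(1,3)[of n] by (simp add: \<epsilon>_def)
  define b where "b x = case_nat \<phi> (\<lambda>j. h (x j))" for x :: "nat \<Rightarrow> 'a"
  have "\<exists>x. \<forall>n. Q n (x n) \<and> almost_orthogonal (\<epsilon> (Suc n)) (span (b x ` {..n})) (h (x n))"
  proof (rule dependent_wellorder_choice)
    show "\<exists>z. Q n z \<and> almost_orthogonal (\<epsilon> (Suc n)) (span (b x ` {..n})) (h z)" for n x
      by (rule ex_orthogonal[OF _ \<epsilon>]) simp
    fix x x' :: "nat \<Rightarrow> 'a" and n z assume "\<And>j. j < n \<Longrightarrow> x j = x' j"
    then have "b x ` {..n} = b x' ` {..n}"
      unfolding b_def by (intro image_cong) (auto split: nat.split)
    then show "(Q n z \<and> almost_orthogonal (\<epsilon> (Suc n)) (span (b x ` {..n})) (h z)) =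
        (Q n z \<and> almost_orthogonal (\<epsilon> (Suc n)) (span (b x' ` {..n})) (h z))" by simp
  qed
  then obtain x where x: "\<And>n. Q n (x n)"
    "\<And>n. almost_orthogonal (\<epsilon> (Suc n)) (span (b x ` {..n})) (h (x n))"
    by blast
  have "almost_orthogonal (\<epsilon> n) (span (b x ` {..<n})) (b x n)" for n
  proof (cases n)
    case 0
    then show ?thesis by (simp add: almost_orthogonal_def)
  next
    case (Suc k)
    with x(2)[of k] show ?thesis by (simp add: b_def lessThan_Suc_atMost)
  qed
  then have "basis_constant_le C (b x)"
    by (intro basis_constant_le_if_almost_orthogonal[OF g(1,2)]) (simp add: \<epsilon>_def)
  with x(1) show ?thesis unfolding b_def by blast
qed

lemma not_tauberian_imp_ex_basic_sequence_summable_image: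
  fixes T :: "'a::banach \<Rightarrow>\<^sub>L 'b::real_normed_vector"
  assumes "\<not> tauberian T"
  shows "\<exists>(x :: nat \<Rightarrow> 'a) C (s :: 'a \<Rightarrow>\<^sub>L real) M y. basis_constant_le C x \<and>
    (\<forall>j. s (x j) = 1 \<and> norm (x j) \<le> M) \<and> summable (\<lambda>j. norm (T (x j) - y))"
proof -
  obtain \<phi> y where \<phi>: "\<phi> \<notin> range canon" and y: "bidual_op T \<phi> = canon y"
    using assms by (auto simp: tauberian_def)
  define d where "d = infdist \<phi> (range canon)"
  have d: "0 < d"
    unfolding d_def using \<phi> by (intro infdist_pos_not_in_closed closed_range_canon) auto
  have d_le: "d \<le> norm (\<phi> - u)" if "u \<in> range canon" for u
    unfolding d_def using infdist_le[OF that, of \<phi>] by (simp add: dist_norm)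
  have "\<exists>x. (\<forall>n. norm (x n) \<le> norm \<phi> \<and> norm (T (x n) - y) \<le> (1/2) ^ n) \<and>
      basis_constant_le 2 (case_nat \<phi> (\<lambda>j. canon (x j) - \<phi>))"
    by (rule ex_selection_basis_constant_le)
       (use ex_approximation_almost_orthogonal[OF y d d_le[OF rangeI]] in simp_all)
  then obtain x where x: "\<And>n. norm (x n) \<le> norm \<phi>" "\<And>n. norm (T (x n) - y) \<le> (1/2) ^ n"
    "basis_constant_le 2 (case_nat \<phi> (\<lambda>j. canon (x j) - \<phi>))"
    by blast
  have "subspace (range canon)"
    by (rule linear_subspace_image[OF linear_canon subspace_UNIV])
  note shift = x(3) this rangeI d d_le
  have "dominates (2 / d) x (\<lambda>_. 1::real)"
    using dominates_one_if_basis_constant_le_shift[OF shift]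
    by (simp add: dominates_def flip: canon_sum_scaleR)
  then obtain s :: "'a \<Rightarrow>\<^sub>L real" where "\<And>j. s (x j) = 1"
    using ex_blinfun_if_dominates by blast
  moreover have "basis_constant_le (2 + 2 / d * norm \<phi>) x"
    using basis_constant_le_if_basis_constant_le_shift[OF shift]
    by (simp add: basis_constant_le_def flip: canon_sum_scaleR)
  moreover have "summable (\<lambda>j. norm (T (x j) - y))"
    using x(2) by (intro summable_comparison_test'[OF summable_geometric[of "1/2::real"]]) auto
  ultimately show ?thesis using x(1) by blast
qed

lemma summable_norm_diff_imp_LIMSEQ:
  fixes z :: "nat \<Rightarrow> 'a::real_normed_vector"
  shows "summable (\<lambda>n. norm (z n - y)) \<Longrightarrow> z \<longlonglongrightarrow> y"
  by (rule LIM_zero_cancel, rule tendsto_norm_zero_cancel, rule summable_LIMSEQ_zero)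

lemma summable_norm_diff_imp_summable_norm_Suc_diff:
  fixes z :: "nat \<Rightarrow> 'a::real_normed_vector"
  assumes "summable (\<lambda>n. norm (z n - y))"
  shows "summable (\<lambda>n. norm (z (Suc n) - z n))"
proof (rule summable_comparison_test')
  show "summable (\<lambda>n. norm (z (Suc n) - y) + norm (z n - y))"
    using assms by (intro summable_add) (simp_all add: summable_Suc_iff[of "\<lambda>n. norm (z n - y)"])
  show "norm (norm (z (Suc n) - z n)) \<le> norm (z (Suc n) - y) + norm (z n - y)" for n
    using norm_triangle_ineq4[of "z (Suc n) - y" "z n - y"] by simp
qed

theorem theorem5:
  fixes T :: "'a::banach \<Rightarrow>\<^sub>L 'b::banach"
  shows "(\<not> tauberian T \<longleftrightarrow> (\<exists>x. wide_s x \<and> convergent (\<lambda>j. T (x j))))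
       \<and> (\<not> tauberian T \<longleftrightarrow> (\<exists>e. wide_c e \<and> summable (\<lambda>j. norm (T (e j)))))"
proof -
  have "(\<exists>x. wide_s x \<and> convergent (\<lambda>j. T (x j))) \<and> (\<exists>e. wide_c e \<and> summable (\<lambda>j. norm (T (e j))))"
    if "\<not> tauberian T"
  proof -
    obtain x :: "nat \<Rightarrow> 'a" and C M y and s :: "'a \<Rightarrow>\<^sub>L real"
      where x: "basis_constant_le C x" "\<And>j. s (x j) = 1" "\<And>j. norm (x j) \<le> M"
      and Tx: "summable (\<lambda>j. norm (T (x j) - y))"
      using not_tauberian_imp_ex_basic_sequence_summable_image[OF \<open>\<not> tauberian T\<close>] by blast
    have "convergent (\<lambda>j. T (x j))"
      using summable_norm_diff_imp_LIMSEQ[OF Tx] by (rule convergentI)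
    moreover have "summable (\<lambda>j. norm (T (x (Suc j) - x j)))"
      using summable_norm_diff_imp_summable_norm_Suc_diff[OF Tx] by (simp add: blinfun.diff_right)
    ultimately show ?thesis
      using wide_sI[OF x] wide_c_differences[OF x] by blast
  qed
  with wide_s_imp_not_tauberian wide_c_imp_not_tauberian show ?thesis by blast
qed

end
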